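(* Let $m\ge2$ and let $f_1,\dots,f_m:\mathbb{R}^n\to\mathbb{R}$ be differentiable with $L$-Lipschitz gradients and $\mathbb{E}[f_i(x_k)]\ge F_{\inf}>-\infty$ for all $i\in[m]$ and all iterates $x_k$. Assume that at every iterate $x_k$ and for all $i\in[m]$ $$\nabla f_i(x_k)=\mathbb{E}[\nabla f_i(x_k;\xi)],\qquad \mathbb{E}\|\nabla f_i(x_k;\xi)\|_2^2\le C_f^2,\qquad \mathbb{E}\|\nabla f_i(x_k;\xi)-\nabla f_i(x_k)\|_2^2\le\delta^2,$$ with $C_f>0$, $\delta\ge0$. Let $$M_*^2=(2+\ln m)m^2C_f^4+\left(\tfrac12+\ln m\right)m^2C_f^2\delta^2,\qquad M_2=\left(\frac{2\bar D_{\omega_z,Z}^2S}{S-\lceil rS\rceil+1}+2\sqrt{\frac{S}{\lceil rS\rceil}}\right)\max\{\theta,\theta^{-1}\}M_*,$$ $M_f=\max_{i\in[m]}f_i(x_0)-F_{\inf}$. Run the MSMD method (defined in the context) with varying inner step size $\gamma_s=\frac{\theta}{M_*\sqrt s}$ ($s\ge1$), $\theta>0$, and varying outer step size $\alpha_k=\frac{\rho}{k+1}$, $\rho>0$. Put $A_{K-1}=\sum_{k=0}^{K-1}\alpha_k$. (a) If $S=(K+1)^2$, then $$\frac1{A_{K-1}}\sum_{k=0}^{K-1}\alpha_k\,\mathbb{E}\|d_k\|_2^2\le O\left(\frac{\max\left\{LmC_f^2\rho\pi^23^{-1},\,2M_f\rho^{-1}\right\}}{\ln(K+1)}\right).$$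 (b) If $S=(k+1)^2$ at outer iteration $k$, then, with the finite constants $\zeta(\tfrac32)=\sum_{k\ge1}k^{-3/2}$ and $\zeta(3)=\sum_{k\ge1}k^{-3}$, $$\frac1{A_{K-1}}\sum_{k=0}^{K-1}\alpha_k\,\mathbb{E}\|d_k\|_2^2\le O\left(\max\left\{LmC_f^2\rho\pi^23^{-1},\,2\zeta(\tfrac32)C_fM_2^{1/2},\,2\zeta(3)L\rho M_2,\,2M_f\rho^{-1}\right\}\frac{1}{\ln(K+1)}\right).$$
   Context: $\nabla f_i(x;\xi)$ is a stochastic gradient of $f_i$, $\xi$ a random vector with a fixed distribution supported on $\Xi$. In the assumptions on stochastic gradients, $\mathbb{E}$ is over $\xi$ with $x_k$ held fixed; elsewhere it is total expectation. $[m]=\{1,\dots,m\}$, $\Delta^m=\{\lambda\in\mathbb{R}^m:\lambda\ge0,\sum_i\lambda_i=1\}$, $C=\{d\in\mathbb{R}^n:\|d\|_2\le C_f\}$, $Z=C\times\Delta^m$. "$a_K\le O(b_K)$" means: there is a constant $c>0$ not depending on $K$ (it may depend on the fixed problem and method constants) with $a_K\le c\,b_K$ for all $K\ge1$. In (b), where $S$ depends on $k$, $M_2$ is read as the maximum of the displayed expression over $S=(k+1)^2$, $0\le k\le K-1$. Steepest common descent direction at $x_k$: $d_k=\arg\min_{d\in\mathbb{R}^n}\max_{i\in[m]}\nabla f_i(x_k)^Td+\frac12\|d\|_2^2$. Subproblem gradient at $x_k$: for $z=(d,\lambda)\in Z$, $$\nabla\phi_z(z;\xi)=\Big(\sum_{i=1}^m\lambda_i\nabla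 f_i(x_k;\xi)+d,\ -\big(\langle\nabla f_i(x_k;\xi),d\rangle\big)_{i=1}^m\Big)\in\mathbb{R}^{n}\times\mathbb{R}^m.$$ Bregman data: $\omega_z(d,\lambda)=\frac{1}{2C_f^2}\|d\|_2^2+\frac{1}{2\ln m}\sum_{i=1}^m\lambda_i\ln\lambda_i$ on $Z$ (with $0\ln0=0$), $V(u,v)=\omega_z(v)-\omega_z(u)-\nabla\omega_z(u)^T(v-u)$, prox-mapping $P_z(\zeta)=\arg\min_{u\in Z}\{\zeta^T(u-z)+V(z,u)\}$, and $\bar D_{\omega_z,Z}=\sup_{u,v\in Z}\sqrt{2V(u,v)}$. The paper takes $V(u,v)\le\frac12\bar D_{\omega_z,Z}^2<+\infty$ for all $u,v\in Z$. MSMD method (number of inner steps $S$, inner step sizes $\gamma_s$, outer step sizes $\alpha_k$, ratio $r\in(0,1)$, $P=\lceil rS\rceil$): given $x_0\in\mathbb{R}^n$, at outer iteration $k=0,\dots,K-1$ set $d_{k,0}=0$, $\lambda_{k,0}=(1/m,\dots,1/m)$; for $s=0,\dots,S-1$ draw an i.i.d. sample $\xi_s$ (independent of $x_k$ and of all earlier samples) and set $z_{k,s+1}=P_{z_{k,s}}(\gamma_s\nabla\phi_z(z_{k,s};\xi_s))$; then set $z_{k,P}^S=(d_{k,P}^S,\lambda_{k,P}^S)=\big(\sum_{s=P}^S\gamma_s z_{k,s}\big)/\sum_{s=P}^S\gamma_s$ and $x_{k+1}=x_k+\alpha_k d_{k,P}^S$. The step $\gamma_0>0$ is arbitrary.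
   Formalization: The supremum D̄ is in fact +∞ for this entropy, so the assumption that it is finite cannot hold; the formal version drops that assumption and reads D̄ as 0 in M_2 when the supremum is infinite, which gives a bound in (b) at least as strong as for any finite D̄. *)

theory Defs
  imports "HOL-Probability.Probability"
begin

definition grad :: "('a::real_inner \<Rightarrow> real) \<Rightarrow> 'a \<Rightarrow> 'a" where
  "grad f x = (THE g. GDERIV f x :> g)"

definition descent_dir :: "('m::finite \<Rightarrow> real ^ 'n \<Rightarrow> real) \<Rightarrow> real ^ 'n \<Rightarrow> real ^ 'n" where
  "descent_dir f x =
     arg_min_on (\<lambda>d. Max (range (\<lambda>i. grad (f i) x \<bullet> d)) + (norm d)\<^sup>2 / 2) UNIV"

definition prob_simplex :: "(real ^ 'm) set" where
  "prob_simplex = {l. (\<forall>i. 0 \<le> l $ i) \<and> (\<Sum>i\<in>UNIV. l $ i) = 1}"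

definition feasible :: "real \<Rightarrow> ((real ^ 'n) \<times> (real ^ 'm)) set" where
  "feasible Cf = cball 0 Cf \<times> prob_simplex"

(* The value of ln at 0 is irrelevant here: 0 * ln 0 = 0. *)
definition omega :: "real \<Rightarrow> (real ^ 'n) \<times> (real ^ 'm) \<Rightarrow> real" where
  "omega Cf z =
     (norm (fst z))\<^sup>2 / (2 * Cf\<^sup>2)
     + (1 / (2 * ln (real CARD('m)))) * (\<Sum>i\<in>UNIV. snd z $ i * ln (snd z $ i))"

(* The gradient of omega exists at u = (d, l) if all l $ i are positive.  Its value, and hence
   bregman Cf u v, is meaningless if some l $ i = 0; the MSMD iterates stay away from such points. *)
definition bregman :: "real \<Rightarrow> (real ^ 'n) \<times> (real ^ 'm) \<Rightarrow> (real ^ 'n) \<times> (real ^ 'm) \<Rightarrow> real" where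
  "bregman Cf u v = omega Cf v - omega Cf u - grad (omega Cf) u \<bullet> (v - u)"

definition prox ::
  "real \<Rightarrow> (real ^ 'n) \<times> (real ^ 'm) \<Rightarrow> (real ^ 'n) \<times> (real ^ 'm) \<Rightarrow> (real ^ 'n) \<times> (real ^ 'm)" where
  "prox Cf z zeta = arg_min_on (\<lambda>u. zeta \<bullet> (u - z) + bregman Cf z u) (feasible Cf)"

definition Dbar_ext :: "real \<Rightarrow> ((real ^ 'n) \<times> (real ^ 'm)) itself \<Rightarrow> ereal" where
  "Dbar_ext Cf T =
     (SUP u\<in>(feasible Cf :: ((real ^ 'n) \<times> (real ^ 'm)) set). SUP v\<in>feasible Cf.
        ereal (sqrt (2 * bregman Cf u v)))"

(* The literature takes the supremum Dbar_ext to be finite, and Dbar is then its value.  For at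
   least two objectives this is never so: the entropy part of bregman Cf u v tends to infinity when
   v is fixed and u approaches the boundary of the simplex.  Finiteness of Dbar_ext as a hypothesis
   would therefore make every statement about the method vacuous, and an infinite M2 would make
   every bound in terms of M2 trivial.  No finiteness is assumed; real_of_ereal sends infinity to 0,
   which gives M2 the smallest value it has for any Dbar in [0, infinity].  An upper bound that is
   nondecreasing in M2 is therefore only made stronger by this convention. *)
definition Dbar :: "real \<Rightarrow> ((real ^ 'n) \<times> (real ^ 'm)) itself \<Rightarrow> real" where
  "Dbar Cf T = real_of_ereal (Dbar_ext Cf T)"

(* m is the number of objectives. *)
definition Mstar :: "nat \<Rightarrow> real \<Rightarrow> real \<Rightarrow> real" where
  "Mstar m Cf \<delta> =
     sqrt ((2 + ln (real m)) * (real m)\<^sup>2 * Cf ^ 4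
           + (1 / 2 + ln (real m)) * (real m)\<^sup>2 * Cf\<^sup>2 * \<delta>\<^sup>2)"

definition avg_start :: "real \<Rightarrow> nat \<Rightarrow> nat" where
  "avg_start r S = nat \<lceil>r * real S\<rceil>"

(* D stands for Dbar and Ms for Mstar. *)
definition M2 :: "real \<Rightarrow> real \<Rightarrow> real \<Rightarrow> real \<Rightarrow> nat \<Rightarrow> real" where
  "M2 D Ms \<theta> r S =
     (2 * D\<^sup>2 * real S / (real S - real (avg_start r S) + 1)
      + 2 * sqrt (real S / real (avg_start r S))) * max \<theta> (1 / \<theta>) * Ms"

(* g i is the sample of the gradient of the i-th objective. *)
definition grad_phi ::
  "('m::finite \<Rightarrow> real ^ 'n) \<Rightarrow> (real ^ 'n) \<times> (real ^ 'm) \<Rightarrow> (real ^ 'n) \<times> (real ^ 'm)" where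
  "grad_phi g z = ((\<Sum>i\<in>UNIV. snd z $ i *\<^sub>R g i) + fst z, - (\<chi> i. g i \<bullet> fst z))"

(* Inner loop at the point x; G i x e is the stochastic gradient of the i-th objective at x for the
   sample e, and xs s is the s-th sample. *)
primrec inner_iter ::
  "('m::finite \<Rightarrow> real ^ 'n \<Rightarrow> 'e \<Rightarrow> real ^ 'n) \<Rightarrow> real \<Rightarrow> (nat \<Rightarrow> real) \<Rightarrow> real ^ 'n \<Rightarrow> (nat \<Rightarrow> 'e)
     \<Rightarrow> nat \<Rightarrow> (real ^ 'n) \<times> (real ^ 'm)" where
  "inner_iter G Cf \<gamma> x xs 0 = (0, \<chi> i. 1 / real CARD('m))"
| "inner_iter G Cf \<gamma> x xs (Suc s) =
     prox Cf (inner_iter G Cf \<gamma> x xs s)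
       (\<gamma> s *\<^sub>R grad_phi (\<lambda>i. G i x (xs s)) (inner_iter G Cf \<gamma> x xs s))"

definition averaged :: "real \<Rightarrow> (nat \<Rightarrow> real) \<Rightarrow> nat \<Rightarrow> (nat \<Rightarrow> 'a::real_vector) \<Rightarrow> 'a" where
  "averaged r \<gamma> S z =
     (1 / (\<Sum>s = avg_start r S..S. \<gamma> s)) *\<^sub>R (\<Sum>s = avg_start r S..S. \<gamma> s *\<^sub>R z s)"

(* S k is the number of inner steps at outer iteration k, and xs k s is the sample used there in
   inner step s. *)
primrec msmd ::
  "('m::finite \<Rightarrow> real ^ 'n \<Rightarrow> 'e \<Rightarrow> real ^ 'n) \<Rightarrow> real \<Rightarrow> real \<Rightarrow> (nat \<Rightarrow> real) \<Rightarrow> (nat \<Rightarrow> real)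
     \<Rightarrow> (nat \<Rightarrow> nat) \<Rightarrow> real ^ 'n \<Rightarrow> (nat \<Rightarrow> nat \<Rightarrow> 'e) \<Rightarrow> nat \<Rightarrow> real ^ 'n" where
  "msmd G Cf r \<gamma> \<alpha> S x0 xs 0 = x0"
| "msmd G Cf r \<gamma> \<alpha> S x0 xs (Suc k) =
     msmd G Cf r \<gamma> \<alpha> S x0 xs k
     + \<alpha> k *\<^sub>R fst (averaged r \<gamma> (S k)
                    (inner_iter G Cf \<gamma> (msmd G Cf r \<gamma> \<alpha> S x0 xs k) (xs k)))"

(* Expectation over a fresh sample with law N, the point x being held fixed. *)
definition stochastic_gradient_at ::
  "('m::finite \<Rightarrow> real ^ 'n \<Rightarrow> real) \<Rightarrow> ('m \<Rightarrow> real ^ 'n \<Rightarrow> 'e \<Rightarrow> real ^ 'n) \<Rightarrow> 'e measure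
     \<Rightarrow> real \<Rightarrow> real \<Rightarrow> real ^ 'n \<Rightarrow> bool" where
  "stochastic_gradient_at f G N Cf \<delta> x \<longleftrightarrow>
     (\<forall>i. has_bochner_integral N (G i x) (grad (f i) x)
        \<and> (\<integral>\<^sup>+e. ennreal ((norm (G i x e))\<^sup>2) \<partial>N) \<le> ennreal (Cf\<^sup>2)
        \<and> (\<integral>\<^sup>+e. ennreal ((norm (G i x e - grad (f i) x))\<^sup>2) \<partial>N) \<le> ennreal (\<delta>\<^sup>2))"

(* What is assumed at a random iterate X on the sample space M. *)
definition iterate_ok ::
  "('m::finite \<Rightarrow> real ^ 'n \<Rightarrow> real) \<Rightarrow> ('m \<Rightarrow> real ^ 'n \<Rightarrow> 'e \<Rightarrow> real ^ 'n) \<Rightarrow> 'e measure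
     \<Rightarrow> real \<Rightarrow> real \<Rightarrow> real \<Rightarrow> 'w measure \<Rightarrow> ('w \<Rightarrow> real ^ 'n) \<Rightarrow> bool" where
  "iterate_ok f G N Cf \<delta> Finf M X \<longleftrightarrow>
     (\<forall>i. Finf \<le> (\<integral>w. f i (X w) \<partial>M)) \<and> (AE w in M. stochastic_gradient_at f G N Cf \<delta> (X w))"

end

theory Submission
  imports Defs
begin

text \<open>The direction \<open>d\<close> at \<open>x\<close> is minus the shortest convex combination of the gradients;
  with the weights \<open>l\<close> of that combination, \<open>(d, l)\<close> is a saddle point of the subproblem.  The
  operator of the subproblem is monotone, and its products with \<open>z - (d, l)\<close> are at least
  \<open>\<parallel>d\<^sub>z - d\<parallel>\<^sup>2\<close>.  The regret of mirror descent from the first step on therefore bounds any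
  partial sum of the weighted squared distances, in particular the one over the averaging window,
  by \<open>V(z\<^sub>0, (d, l)) + O(\<Sum> \<gamma>\<^sub>s\<^sup>2) = O(1 + ln S)\<close>.  Only the distance from the uniform
  weights enters, so the supremum of the Bregman distance, which is infinite, is never needed.
  As the window has total weight of order \<open>\<surd>S\<close>, the averaged direction has expected error
  \<open>O(S\<^bsup>-1/8\<^esup>)\<close>.  With \<open>\<surd>S \<ge> k + 1\<close> this is summable against \<open>\<alpha>\<^sub>k\<close>, and telescoping the
  descent inequality of a single objective bounds \<open>\<Sum> \<alpha>\<^sub>k E \<parallel>d\<^sub>k\<parallel>\<^sup>2\<close> uniformly in \<open>K\<close>.

  The factor in the bound can vanish only in (a), and then \<open>L = 0\<close>: the gradients are constant, and
  the bound itself, with \<open>K\<close> tending to infinity, shows \<open>d = 0\<close>.\<close>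

subsection \<open>Gradients\<close>

text \<open>\<open>arg_min_on\<close> is a Hilbert choice among the minimisers, so strictness of the
  minimum is what pins down its value.\<close>

lemma arg_min_on_eqI:
  fixes f :: "'a \<Rightarrow> 'b::linorder"
  assumes "a \<in> S" and "\<And>y. y \<in> S \<Longrightarrow> y \<noteq> a \<Longrightarrow> f a < f y"
  shows "arg_min_on f S = a"
  unfolding arg_min_on_def arg_min_def is_arg_min_linorder
proof (rule some_equality)
  show "a \<in> S \<and> (\<forall>y. y \<in> S \<longrightarrow> f a \<le> f y)"
    using assms by (metis less_imp_le order.refl)
next
  fix x assume "x \<in> S \<and> (\<forall>y. y \<in> S \<longrightarrow> f x \<le> f y)"
  then show "x = a" using assms by (metis linorder_not_less)
qed

lemma grad_eqI:
  assumes "GDERIV f x :> g"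
  shows "grad f x = g"
  unfolding grad_def
proof (rule the_equality)
  show "GDERIV f x :> g" by (rule assms)
next
  fix g' assume "GDERIV f x :> g'"
  then have "(\<lambda>h. h \<bullet> g') = (\<lambda>h. h \<bullet> g)"
    using assms has_derivative_unique unfolding gderiv_def by blast
  then show "g' = g" by (metis vector_eq_rdot inner_commute)
qed

text \<open>Riesz representation: a derivative is the inner product with the vector of its values on
  the basis. This gives the definite description in \<open>grad\<close> its intended
  meaning.\<close>

lemma GDERIV_grad:
  fixes f :: "'a::euclidean_space \<Rightarrow> real"
  assumes "f differentiable (at x)"
  shows "GDERIV f x :> grad f x"
proof -
  obtain D where D: "(f has_derivative D) (at x)"
    using assms unfolding differentiable_def by blast
  interpret D: linear D by (rule has_derivative_linear[OF D])
  have "D h = h \<bullet> (\<Sum>b\<in>Basis. D b *\<^sub>R b)" for h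
  proof -
    have "D h = D (\<Sum>b\<in>Basis. (h \<bullet> b) *\<^sub>R b)" by (simp add: euclidean_representation)
    also have "\<dots> = (\<Sum>b\<in>Basis. (h \<bullet> b) * D b)" by (simp add: D.sum D.scaleR)
    finally show ?thesis by (simp add: inner_sum_right mult.commute)
  qed
  then have "GDERIV f x :> (\<Sum>b\<in>Basis. D b *\<^sub>R b)"
    using D unfolding gderiv_def by (metis (no_types, lifting) ext)
  then show ?thesis using grad_eqI by metis
qed

text \<open>Mean value theorem on the segment from x to y, then Lipschitz continuity at the
  intermediate point. The constant is \<open>L\<close> rather than L/2, which is harmless in an
  O-bound.\<close>

lemma lipschitz_grad_upper_bound:
  fixes f :: "'a::euclidean_space \<Rightarrow> real"
  assumes diff: "\<And>x. f differentiable (at x)" and lip: "L-lipschitz_on UNIV (grad f)"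
  shows "f y \<le> f x + grad f x \<bullet> (y - x) + L * (norm (y - x))\<^sup>2"
proof -
  define h where "h t = f (x + t *\<^sub>R (y - x))" for t :: real
  have "(h has_real_derivative grad f (x + t *\<^sub>R (y - x)) \<bullet> (y - x)) (at t)" for t
  proof -
    have "(f has_derivative (\<lambda>h. h \<bullet> grad f (x + t *\<^sub>R (y - x)))) (at (x + t *\<^sub>R (y - x)))"
      using GDERIV_grad[OF diff] unfolding gderiv_def .
    then have "((\<lambda>t. f (x + t *\<^sub>R (y - x))) has_derivative
        (\<lambda>s. (s *\<^sub>R (y - x)) \<bullet> grad f (x + t *\<^sub>R (y - x)))) (at t)"
      by (intro has_derivative_compose[of "\<lambda>t. x + t *\<^sub>R (y - x)", where g = f])
         (auto intro!: derivative_eq_intros)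
    then show ?thesis
      unfolding has_field_derivative_def h_def
      by (rule has_derivative_eq_rhs) (auto simp: fun_eq_iff inner_commute mult.commute)
  qed
  from MVT2[of 0 1, OF _ this] obtain t where t: "0 < t" "t < 1"
    and ht: "h 1 - h 0 = grad f (x + t *\<^sub>R (y - x)) \<bullet> (y - x)" by auto
  have L: "0 \<le> L" using lip by (rule lipschitz_on_nonneg)
  have "(grad f (x + t *\<^sub>R (y - x)) - grad f x) \<bullet> (y - x)
      \<le> norm (grad f (x + t *\<^sub>R (y - x)) - grad f x) * norm (y - x)"
    by (rule norm_cauchy_schwarz)
  also have "\<dots> \<le> (L * norm (y - x)) * norm (y - x)"
  proof (intro mult_right_mono norm_ge_zero)
    have "norm (grad f (x + t *\<^sub>R (y - x)) - grad f x) \<le> L * (t * norm (y - x))"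
      using lipschitz_onD[OF lip, of "x + t *\<^sub>R (y - x)" x] t by (simp add: dist_norm)
    also have "\<dots> \<le> L * (1 * norm (y - x))"
      using t L by (intro mult_left_mono mult_right_mono) auto
    finally show "norm (grad f (x + t *\<^sub>R (y - x)) - grad f x) \<le> L * norm (y - x)" by simp
  qed
  finally show ?thesis using ht
    by (simp add: h_def inner_diff_left power2_eq_square mult.assoc)
qed

subsection \<open>The steepest common descent direction\<close>

lemma prob_simplex_nonneg: "l \<in> prob_simplex \<Longrightarrow> 0 \<le> l $ i"
  and prob_simplex_sum: "l \<in> prob_simplex \<Longrightarrow> (\<Sum>i\<in>UNIV. l $ i) = 1"
  by (auto simp: prob_simplex_def)

lemma prob_simplex_le_1:
  assumes "l \<in> prob_simplex"
  shows "l $ i \<le> 1"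
proof -
  have "l $ i \<le> (\<Sum>i\<in>UNIV. l $ i)"
    using assms by (intro member_le_sum) (auto simp: prob_simplex_def)
  then show ?thesis using prob_simplex_sum[OF assms] by simp
qed

lemma axis_in_prob_simplex: "axis i 1 \<in> prob_simplex"
  by (auto simp: prob_simplex_def axis_def)

lemma convex_prob_simplex: "convex prob_simplex"
  by (auto simp: prob_simplex_def convex_def sum.distrib simp flip: sum_distrib_left)

lemma compact_prob_simplex: "compact (prob_simplex :: (real ^ 'm) set)"
  unfolding compact_eq_bounded_closed
proof
  have "(prob_simplex :: (real ^ 'm) set) \<subseteq> cbox 0 (\<chi> i. 1)"
    using prob_simplex_le_1 prob_simplex_nonneg by (auto simp: mem_box_cart)
  then show "bounded (prob_simplex :: (real ^ 'm) set)"
    using bounded_cbox bounded_subset by blast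
  show "closed (prob_simplex :: (real ^ 'm) set)"
    unfolding prob_simplex_def
    by (intro closed_Collect_conj closed_Collect_all closed_Collect_le closed_Collect_eq
        continuous_intros)
qed

text \<open>The convex hull of the vectors is a linear image of the simplex, hence compact and
  convex, and \<open>l\<close> represents its point nearest to 0. The inequality is the obtuse-angle
  condition of that projection, tested at each \<open>g j\<close>.\<close>

lemma min_norm_convex_combination:
  fixes g :: "'m::finite \<Rightarrow> 'a::euclidean_space"
  obtains l :: "real ^ 'm" where "l \<in> prob_simplex"
    "\<And>j. (norm (\<Sum>i\<in>UNIV. l $ i *\<^sub>R g i))\<^sup>2 \<le> g j \<bullet> (\<Sum>i\<in>UNIV. l $ i *\<^sub>R g i)"
proof -
  define c where "c l = (\<Sum>i\<in>UNIV. l $ i *\<^sub>R g i)" for l :: "real ^ 'm"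
  have lin: "linear c"
    by (intro linearI) (auto simp: c_def scaleR_left_distrib sum.distrib scaleR_sum_right)
  have cmp: "compact (c ` prob_simplex)"
    by (intro compact_continuous_image compact_prob_simplex)
       (auto simp: c_def intro!: continuous_intros)
  have ne: "c ` prob_simplex \<noteq> {}" using axis_in_prob_simplex by blast
  have cl: "closed (c ` prob_simplex)" using cmp compact_imp_closed by blast
  have cv: "convex (c ` prob_simplex)"
    using convex_linear_image[OF lin convex_prob_simplex] .
  obtain l where l: "l \<in> prob_simplex" "closest_point (c ` prob_simplex) 0 = c l"
    using closest_point_in_set[OF cl ne, of 0] by auto
  have "(norm (c l))\<^sup>2 \<le> g j \<bullet> c l" for j
  proof -
    have "c (axis j 1) = g j"
      by (simp add: c_def axis_def if_distrib[of "\<lambda>t. t *\<^sub>R _"] cong: if_cong)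
    then have "g j \<in> c ` prob_simplex" using axis_in_prob_simplex by (metis imageI)
    from closest_point_dot[OF cv cl this, of 0] l(2) show ?thesis
      by (simp add: power2_norm_eq_inner inner_diff_right inner_commute)
  qed
  with l(1) that show ?thesis unfolding c_def by blast
qed

lemma convex_combination_le:
  fixes a :: "'m::finite \<Rightarrow> real"
  assumes "l \<in> prob_simplex" and "\<And>i. a i \<le> b"
  shows "(\<Sum>i\<in>UNIV. l $ i * a i) \<le> b"
proof -
  have "(\<Sum>i\<in>UNIV. l $ i * a i) \<le> (\<Sum>i\<in>UNIV. l $ i * b)"
    using assms by (intro sum_mono mult_left_mono) (auto simp: prob_simplex_def)
  also have "\<dots> = b" using prob_simplex_sum[OF assms(1)] by (simp flip: sum_distrib_right)
  finally show ?thesis .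
qed

text \<open>Let h be the shortest convex combination. The objective is at most -|h|^2/2 at -h, since
  every gradient has inner product at least |h|^2 with h. At any other d the maximum is at least the
  inner product of h and d, and completing the square leaves a strict gap |d + h|^2/2.\<close>

lemma descent_dir_saddle:
  fixes f :: "'m::finite \<Rightarrow> real ^ 'n \<Rightarrow> real"
  obtains l :: "real ^ 'm" where "l \<in> prob_simplex"
    "(\<Sum>i\<in>UNIV. l $ i *\<^sub>R grad (f i) x) = - descent_dir f x"
    "\<And>i. grad (f i) x \<bullet> descent_dir f x \<le> - (norm (descent_dir f x))\<^sup>2"
proof -
  define g where "g i = grad (f i) x" for i
  obtain l :: "real ^ 'm" where l: "l \<in> prob_simplex"
    "\<And>j. (norm (\<Sum>i\<in>UNIV. l $ i *\<^sub>R g i))\<^sup>2 \<le> g j \<bullet> (\<Sum>i\<in>UNIV. l $ i *\<^sub>R g i)"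
    by (rule min_norm_convex_combination[of g]) blast
  define h where "h = (\<Sum>i\<in>UNIV. l $ i *\<^sub>R g i)"
  define obj where "obj d = Max (range (\<lambda>i. g i \<bullet> d)) + (norm d)\<^sup>2 / 2" for d
  have "obj (- h) \<le> - (norm h)\<^sup>2 / 2"
  proof -
    have "Max (range (\<lambda>i. g i \<bullet> - h)) \<le> - (norm h)\<^sup>2"
      using l(2) unfolding h_def[symmetric] by (intro Max.boundedI) auto
    then show ?thesis unfolding obj_def norm_minus_cancel by linarith
  qed
  moreover have "- (norm h)\<^sup>2 / 2 < obj d" if "d \<noteq> - h" for d
  proof -
    have "h \<bullet> d \<le> Max (range (\<lambda>i. g i \<bullet> d))"
      using convex_combination_le[OF l(1), of "\<lambda>i. g i \<bullet> d"]
      by (auto simp: h_def inner_sum_left intro: Max_ge)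
    moreover have "0 < (norm (d + h))\<^sup>2" using that by (simp add: add_eq_0_iff2)
    moreover have "(norm (d + h))\<^sup>2 = (norm d)\<^sup>2 + 2 * (h \<bullet> d) + (norm h)\<^sup>2"
      by (simp add: power2_norm_eq_inner inner_add inner_commute)
    ultimately show ?thesis unfolding obj_def by (auto simp: field_simps)
  qed
  ultimately have "descent_dir f x = - h"
    unfolding descent_dir_def g_def[symmetric] obj_def[symmetric]
    by (intro arg_min_on_eqI) force+
  then show ?thesis
    using l by (intro that[of l]) (simp_all add: h_def g_def)
qed

text \<open>Cauchy-Schwarz in the saddle inequality. With a bound on the gradients it places the
  direction in the ball of radius \<open>Cf\<close>, so that it is an admissible comparison point
  for the inner loop.\<close>

lemma norm_descent_dir_le:
  "norm (descent_dir f x) \<le> norm (grad (f i) x)"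
proof -
  have "grad (f i) x \<bullet> descent_dir f x \<le> - (norm (descent_dir f x))\<^sup>2"
    using descent_dir_saddle[of f x] by metis
  moreover have "- (grad (f i) x \<bullet> descent_dir f x) \<le> norm (grad (f i) x) * norm (descent_dir f x)"
    using norm_cauchy_schwarz[of "- grad (f i) x" "descent_dir f x"] by simp
  ultimately have "norm (descent_dir f x) * norm (descent_dir f x)
      \<le> norm (grad (f i) x) * norm (descent_dir f x)" by (simp add: power2_eq_square)
  then show ?thesis
    using mult_le_cancel_right by (metis norm_ge_zero norm_le_zero_iff order.trans linorder_not_le)
qed

text \<open>A Hoelder estimate of exponent 1/2. It yields measurability of the direction and, for L
  = 0, its constancy.\<close>

lemma dist_descent_dir_le:
  assumes lip: "\<And>i. L-lipschitz_on UNIV (grad (f i))"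
  shows "(dist (descent_dir f y) (descent_dir f x))\<^sup>2
    \<le> L * dist y x * (norm (descent_dir f x) + norm (descent_dir f y))"
proof -
  define D where "D = descent_dir f"
  \<comment> \<open>The weights that represent the direction at w are tested against the direction
    at z. Adding the version with w and z exchanged produces the squared distance.\<close>
  have half: "(norm (D z))\<^sup>2 - D w \<bullet> D z \<le> L * dist w z * norm (D z)" for w z
  proof -
    obtain l where l: "l \<in> prob_simplex" "(\<Sum>i\<in>UNIV. l $ i *\<^sub>R grad (f i) w) = - D w"
      unfolding D_def using descent_dir_saddle[of f w] by metis
    have "grad (f i) w \<bullet> D z \<le> L * dist w z * norm (D z) - (norm (D z))\<^sup>2" for i
    proof -
      have "(grad (f i) w - grad (f i) z) \<bullet> D z \<le> norm (grad (f i) w - grad (f i) z) * norm (D z)"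
        by (rule norm_cauchy_schwarz)
      also have "\<dots> \<le> L * dist w z * norm (D z)"
        using lipschitz_onD[OF lip[of i], of w z]
        by (intro mult_right_mono) (auto simp: dist_norm)
      finally have "(grad (f i) w - grad (f i) z) \<bullet> D z \<le> L * dist w z * norm (D z)" .
      moreover have "grad (f i) z \<bullet> D z \<le> - (norm (D z))\<^sup>2"
        unfolding D_def using descent_dir_saddle[of f z] by metis
      ultimately show ?thesis by (simp add: inner_diff_left)
    qed
    from convex_combination_le[OF l(1), of "\<lambda>i. grad (f i) w \<bullet> D z", OF this] l(2)
    show ?thesis
      by (simp flip: inner_scaleR_left inner_sum_left)
  qed
  show ?thesis
    using half[of y x] half[of x y] unfolding D_def[symmetric]
      dist_commute[of x y]
    by (simp add: dist_norm[of "D y"] power2_norm_eq_inner inner_diff inner_commute algebra_simps)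
qed

subsection \<open>The prox-mapping\<close>

text \<open>Relative entropy (Kullback-Leibler divergence) of v with respect to u.\<close>

definition kl :: "real ^ 'm \<Rightarrow> real ^ 'm \<Rightarrow> real" where
  "kl v u = (\<Sum>i\<in>UNIV. v $ i * ln (v $ i) - v $ i * ln (u $ i))"

text \<open>Closed form of \<open>bregman\<close> at base points with positive weights, free of the
  definite description in \<open>grad\<close>; see \<open>bregman_eq_breg\<close>.\<close>

definition breg :: "real \<Rightarrow> (real ^ 'n) \<times> (real ^ 'm) \<Rightarrow> (real ^ 'n) \<times> (real ^ 'm) \<Rightarrow> real" where
  "breg Cf u v = (norm (fst v - fst u))\<^sup>2 / (2 * Cf\<^sup>2)
     + kl (snd v) (snd u) / (2 * ln (real CARD('m)))"

text \<open>The exponentiated-gradient update: it minimises relative entropy to \<open>l\<close>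
  minus the linear function given by \<open>y\<close>.\<close>

definition mult_weights :: "real ^ 'm \<Rightarrow> real ^ 'm \<Rightarrow> real ^ 'm" where
  "mult_weights l y = (\<chi> i. l $ i * exp (y $ i) / (\<Sum>j\<in>UNIV. l $ j * exp (y $ j)))"

text \<open>Explicit solution of the prox problem, which separates into a Euclidean projection and a
  multiplicative-weights update. The step lengths \<open>Cf\<^sup>2\<close> and 2 ln m come from the
  scaling of \<open>omega\<close>.\<close>

definition prox_step ::
  "real \<Rightarrow> (real ^ 'n) \<times> (real ^ 'm) \<Rightarrow> (real ^ 'n) \<times> (real ^ 'm) \<Rightarrow> (real ^ 'n) \<times> (real ^ 'm)" where
  "prox_step Cf z \<zeta> = (closest_point (cball 0 Cf) (fst z - Cf\<^sup>2 *\<^sub>R fst \<zeta>),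
     mult_weights (snd z) (- (2 * ln (real CARD('m))) *\<^sub>R snd \<zeta>))"

text \<open>With v = p^2 and u = q^2, the inequality ln t \<le> t - 1 at t = q/p gives the
  Hellinger-type lower bound (p - q)^2. Since p + q \<le> 2, this dominates (v - u)^2/4.\<close>

lemma kl_term_ge:
  fixes v u :: real
  assumes "0 \<le> v" "v \<le> 1" "0 < u" "u \<le> 1"
  shows "(v - u)\<^sup>2 / 4 \<le> v * ln v - v * ln u - v + u"
proof (cases "v = 0")
  case True
  have "u\<^sup>2 \<le> u" using assms by (simp add: power2_eq_square mult_left_le)
  then show ?thesis using True assms by simp
next
  case False
  define p q where "p = sqrt v" and "q = sqrt u"
  have pq: "0 < p" "0 < q" "p \<le> 1" "q \<le> 1" "v = p\<^sup>2" "u = q\<^sup>2"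
    using assms False by (auto simp: p_def q_def)
  have "ln (q / p) \<le> q / p - 1" using pq by (intro ln_le_minus_one) auto
  then have "1 - q / p \<le> ln p - ln q" using pq by (simp add: ln_div)
  then have "2 * p\<^sup>2 * (1 - q / p) \<le> 2 * p\<^sup>2 * (ln p - ln q)"
    using pq by (intro mult_left_mono) auto
  also have "\<dots> = v * ln v - v * ln u" using pq by (simp add: ln_realpow algebra_simps)
  also have "2 * p\<^sup>2 * (1 - q / p) = 2 * p\<^sup>2 - 2 * p * q"
    using pq by (simp add: field_simps power2_eq_square)
  finally have "(p - q)\<^sup>2 \<le> v * ln v - v * ln u - v + u"
    using pq(5,6) by (simp add: power2_eq_square algebra_simps)
  moreover have "(v - u)\<^sup>2 / 4 \<le> (p - q)\<^sup>2"
  proof -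
    have "(p + q)\<^sup>2 \<le> 2\<^sup>2" using pq by (intro power_mono) auto
    then have "(p - q)\<^sup>2 * (p + q)\<^sup>2 \<le> (p - q)\<^sup>2 * 4" by (intro mult_left_mono) auto
    moreover have "(v - u)\<^sup>2 = (p - q)\<^sup>2 * (p + q)\<^sup>2"
      using pq(5,6) by (simp add: power2_eq_square algebra_simps)
    ultimately show ?thesis by simp
  qed
  ultimately show ?thesis by linarith
qed

text \<open>A weak Pinsker inequality in the Euclidean norm: the linear terms of
  \<open>kl_term_ge\<close> cancel because both vectors sum to 1.\<close>

lemma kl_ge:
  assumes v: "v \<in> prob_simplex" and u: "u \<in> prob_simplex" "\<And>i. 0 < u $ i"
  shows "(norm (v - u))\<^sup>2 / 4 \<le> kl v u"
proof -
  have "(norm (v - u))\<^sup>2 / 4 = (\<Sum>i\<in>UNIV. (v $ i - u $ i)\<^sup>2 / 4)"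
    by (simp add: norm_vec_def L2_set_def sum_nonneg sum_divide_distrib)
  also have "\<dots> \<le> (\<Sum>i\<in>UNIV. v $ i * ln (v $ i) - v $ i * ln (u $ i) - v $ i + u $ i)"
    using assms prob_simplex_le_1 prob_simplex_nonneg by (intro sum_mono kl_term_ge) auto
  also have "\<dots> = kl v u"
    using prob_simplex_sum[OF v] prob_simplex_sum[OF u(1)]
    by (simp add: kl_def sum.distrib sum_subtractf)
  finally show ?thesis .
qed

text \<open>The terms v ln v are nonpositive, and the cross term against uniform weights is exactly
  ln m. This bound takes the place of the infinite supremum of the Bregman distance.\<close>

lemma kl_uniform_le:
  fixes v :: "real ^ 'm"
  assumes v: "v \<in> prob_simplex"
  shows "kl v (\<chi> i. 1 / real CARD('m)) \<le> ln (real CARD('m))"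
proof -
  have "kl v (\<chi> i. 1 / real CARD('m)) \<le> (\<Sum>i\<in>UNIV. v $ i * ln (real CARD('m)))"
    unfolding kl_def
  proof (rule sum_mono)
    fix i
    have "v $ i * ln (v $ i) \<le> 0"
      using prob_simplex_nonneg[OF v] prob_simplex_le_1[OF v]
      by (cases "v $ i = 0") (auto simp: mult_le_0_iff less_le)
    then show "v $ i * ln (v $ i) - v $ i * ln ((\<chi> i. 1 / real CARD('m)) $ i)
        \<le> v $ i * ln (real CARD('m))"
      by (simp add: ln_div)
  qed
  also have "\<dots> = ln (real CARD('m))"
    using prob_simplex_sum[OF v] by (simp flip: sum_distrib_right)
  finally show ?thesis .
qed

lemma GDERIV_omega:
  fixes u :: "(real ^ 'n) \<times> (real ^ 'm)"
  assumes pos: "\<And>i. 0 < snd u $ i"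
  shows "GDERIV (omega Cf) u :> ((1 / Cf\<^sup>2) *\<^sub>R fst u,
     \<chi> i. (ln (snd u $ i) + 1) / (2 * ln (real CARD('m))))"
proof -
  have nth: "((\<lambda>z::(real ^ 'n) \<times> (real ^ 'm). snd z $ i) has_derivative (\<lambda>h. snd h $ i)) (at u)" for i
    by (intro bounded_linear_imp_has_derivative bounded_linear_compose[OF bounded_linear_vec_nth]
        bounded_linear_snd)
  have "((\<lambda>z::(real ^ 'n) \<times> (real ^ 'm). (norm (fst z))\<^sup>2 / (2 * Cf\<^sup>2)) has_derivative
      (\<lambda>h. (fst h \<bullet> fst u) / Cf\<^sup>2)) (at u)"
  proof -
    have "((\<lambda>z::(real ^ 'n) \<times> (real ^ 'm). (fst z \<bullet> fst z) * (1 / (2 * Cf\<^sup>2))) has_derivative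
        (\<lambda>h. (fst u \<bullet> fst h + fst h \<bullet> fst u) * (1 / (2 * Cf\<^sup>2)))) (at u)"
      by (intro has_derivative_mult_left has_derivative_inner has_derivative_fst has_derivative_ident)
    then show ?thesis by (simp add: power2_norm_eq_inner inner_commute)
  qed
  moreover have "((\<lambda>z::(real ^ 'n) \<times> (real ^ 'm).
      (1 / (2 * ln (real CARD('m)))) * (\<Sum>i\<in>UNIV. snd z $ i * ln (snd z $ i))) has_derivative
      (\<lambda>h. (1 / (2 * ln (real CARD('m)))) * (\<Sum>i\<in>UNIV. snd h $ i * (ln (snd u $ i) + 1)))) (at u)"
  proof (intro has_derivative_mult_right has_derivative_sum)
    fix i
    show "((\<lambda>z::(real ^ 'n) \<times> (real ^ 'm). snd z $ i * ln (snd z $ i)) has_derivative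
        (\<lambda>h. snd h $ i * (ln (snd u $ i) + 1))) (at u)"
      using pos[of i] by (auto intro!: derivative_eq_intros nth simp: field_simps)
  qed
  ultimately have "(omega Cf has_derivative
      (\<lambda>h. (fst h \<bullet> fst u) / Cf\<^sup>2 +
        (1 / (2 * ln (real CARD('m)))) * (\<Sum>i\<in>UNIV. snd h $ i * (ln (snd u $ i) + 1)))) (at u)"
    unfolding omega_def by (intro has_derivative_add)
  then show ?thesis
    unfolding gderiv_def
    by (rule has_derivative_eq_rhs)
       (simp add: fun_eq_iff inner_prod_def inner_vec_def sum_divide_distrib)
qed

text \<open>The summand 1 in the gradient of the entropy drops out because both weight vectors sum
  to 1.\<close>

lemma bregman_eq_breg:
  fixes u v :: "(real ^ 'n) \<times> (real ^ 'm)"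
  assumes u: "snd u \<in> prob_simplex" "\<And>i. 0 < snd u $ i" and v: "snd v \<in> prob_simplex"
  shows "bregman Cf u v = breg Cf u v"
proof -
  define k where "k = 1 / (2 * ln (real CARD('m)))"
  have kl: "kl (snd v) (snd u) = (\<Sum>i\<in>UNIV. snd v $ i * ln (snd v $ i)) - (\<Sum>i\<in>UNIV. snd u $ i * ln (snd u $ i))
      - (\<Sum>i\<in>UNIV. (ln (snd u $ i) + 1) * (snd v $ i - snd u $ i))"
    using prob_simplex_sum[OF u(1)] prob_simplex_sum[OF v]
    by (simp add: kl_def sum.distrib sum_subtractf algebra_simps)
  have gr: "grad (omega Cf) u \<bullet> (v - u) = (fst u \<bullet> (fst v - fst u)) / Cf\<^sup>2
      + k * (\<Sum>i\<in>UNIV. (ln (snd u $ i) + 1) * (snd v $ i - snd u $ i))"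
    unfolding grad_eqI[OF GDERIV_omega[OF u(2)]]
    by (simp add: k_def inner_prod_def inner_vec_def[where 'b='m] sum_divide_distrib)
  have nm: "(norm (fst v - fst u))\<^sup>2 / (2 * Cf\<^sup>2) = (norm (fst v))\<^sup>2 / (2 * Cf\<^sup>2)
      - (norm (fst u))\<^sup>2 / (2 * Cf\<^sup>2) - (fst u \<bullet> (fst v - fst u)) / Cf\<^sup>2"
    \<comment> \<open>For \<open>Cf = 0\<close> every quotient is 0 by the convention on
      division.\<close>
    by (cases "Cf = 0") (simp_all add: power2_norm_eq_inner inner_diff inner_commute field_simps)
  show ?thesis
    unfolding bregman_def gr breg_def nm kl omega_def
    by (simp add: k_def diff_divide_distrib)
qed

lemma mult_weights_pos:
  assumes "\<And>i. 0 < l $ i"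
  shows "0 < mult_weights l y $ i"
  using assms unfolding mult_weights_def by (auto intro!: divide_pos_pos sum_pos mult_pos_pos)

lemma mult_weights_in_prob_simplex:
  assumes "\<And>i. 0 < l $ i"
  shows "mult_weights l y \<in> prob_simplex"
proof -
  have "0 < (\<Sum>j\<in>UNIV. l $ j * exp (y $ j))"
    using assms by (intro sum_pos mult_pos_pos) auto
  then show ?thesis
    using mult_weights_pos[OF assms, THEN less_imp_le]
    by (auto simp: prob_simplex_def mult_weights_def simp flip: sum_divide_distrib)
qed

text \<open>The logarithm of an updated weight is ln l + y - ln Z with the normaliser Z. Subtracting
  a linear function from the relative entropy thus only moves its base point, up to a constant
  independent of v.\<close>

lemma kl_mult_weights:
  assumes l: "\<And>i. 0 < l $ i" and v: "v \<in> prob_simplex"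
  shows "kl v l - y \<bullet> v = kl v (mult_weights l y) - ln (\<Sum>j\<in>UNIV. l $ j * exp (y $ j))"
proof -
  define Z where "Z = (\<Sum>j\<in>UNIV. l $ j * exp (y $ j))"
  have Z: "0 < Z" unfolding Z_def using l by (intro sum_pos mult_pos_pos) auto
  have "ln (mult_weights l y $ i) = ln (l $ i) + y $ i - ln Z" for i
    using l[of i] Z by (simp add: mult_weights_def Z_def[symmetric] ln_div ln_mult)
  then have "kl v (mult_weights l y) = kl v l - (\<Sum>i\<in>UNIV. v $ i * y $ i) + (\<Sum>i\<in>UNIV. v $ i) * ln Z"
    by (simp add: kl_def sum.distrib sum_subtractf distrib_left right_diff_distrib sum_distrib_right)
  then show ?thesis
    using prob_simplex_sum[OF v] by (simp add: Z_def inner_vec_def mult.commute)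
qed

text \<open>For the weights this is an identity: \<open>kl_mult_weights\<close> at the new point and
  at u, subtracted. For the directions it is the obtuse-angle condition of the projection, rewritten
  by polarisation.\<close>

lemma prox_step_three_point:
  fixes z u \<zeta> :: "(real ^ 'n) \<times> (real ^ 'm)"
  assumes m: "2 \<le> CARD('m)" and Cf: "0 < Cf"
    and z: "\<And>i. 0 < snd z $ i" and u: "u \<in> feasible Cf"
  shows "breg Cf z (prox_step Cf z \<zeta>) + breg Cf (prox_step Cf z \<zeta>) u
    \<le> \<zeta> \<bullet> (u - prox_step Cf z \<zeta>) + breg Cf z u"
proof -
  define c where "c = 2 * ln (real CARD('m))"
  have c: "0 < c" using m by (simp add: c_def)
  define p where "p = prox_step Cf z \<zeta>"
  define y where "y = - c *\<^sub>R snd \<zeta>"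
  have p: "fst p = closest_point (cball 0 Cf) (fst z - Cf\<^sup>2 *\<^sub>R fst \<zeta>)" "snd p = mult_weights (snd z) y"
    by (simp_all add: p_def prox_step_def c_def y_def)
  have u': "fst u \<in> cball 0 Cf" "snd u \<in> prob_simplex"
    using u by (auto simp: feasible_def)
  have sp: "snd p \<in> prob_simplex" unfolding p by (rule mult_weights_in_prob_simplex[OF z])
  have "kl (snd p) (snd p) = 0" by (simp add: kl_def)
  with kl_mult_weights[OF z sp, of y] kl_mult_weights[OF z u'(2), of y]
  have "kl (snd p) (snd z) + kl (snd u) (snd p) = kl (snd u) (snd z) - y \<bullet> (snd u - snd p)"
    unfolding p(2)[symmetric] by (simp add: inner_diff_right)
  then have L: "kl (snd p) (snd z) / c + kl (snd u) (snd p) / c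
      = kl (snd u) (snd z) / c + snd \<zeta> \<bullet> (snd u - snd p)"
    using c by (simp add: y_def field_simps)
  have "(fst z - Cf\<^sup>2 *\<^sub>R fst \<zeta> - fst p) \<bullet> (fst u - fst p) \<le> 0"
    unfolding p(1) using u'(1) by (intro closest_point_dot) auto
  then have "((fst z - fst p) \<bullet> (fst u - fst p)) / Cf\<^sup>2 \<le> fst \<zeta> \<bullet> (fst u - fst p)"
    using Cf by (simp add: inner_diff_left inner_add_left field_simps)
  moreover have "((fst z - fst p) \<bullet> (fst u - fst p)) / Cf\<^sup>2
      = (norm (fst p - fst z))\<^sup>2 / (2 * Cf\<^sup>2) + (norm (fst u - fst p))\<^sup>2 / (2 * Cf\<^sup>2)
        - (norm (fst u - fst z))\<^sup>2 / (2 * Cf\<^sup>2)"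
    using Cf by (simp add: power2_norm_eq_inner inner_diff inner_commute field_simps)
  ultimately show ?thesis
    using L unfolding breg_def c_def[symmetric] p_def[symmetric] inner_prod_def
    by simp
qed

text \<open>Strong convexity of \<open>omega\<close>; the factor 8 is the 4 of \<open>kl_ge\<close>
  times the 2 in the scaling of the entropy.\<close>

lemma breg_ge:
  fixes z u :: "(real ^ 'n) \<times> (real ^ 'm)"
  assumes m: "2 \<le> CARD('m)"
    and u: "snd u \<in> prob_simplex"
    and z: "snd z \<in> prob_simplex" "\<And>i. 0 < snd z $ i"
  shows "(norm (fst u - fst z))\<^sup>2 / (2 * Cf\<^sup>2)
      + (norm (snd u - snd z))\<^sup>2 / (8 * ln (real CARD('m))) \<le> breg Cf z u"
  using divide_right_mono[OF kl_ge[OF u z], of "2 * ln (real CARD('m))"] m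
  by (simp add: breg_def)

lemma breg_nonneg:
  fixes z u :: "(real ^ 'n) \<times> (real ^ 'm)"
  assumes m: "2 \<le> CARD('m)"
    and u: "snd u \<in> prob_simplex"
    and z: "snd z \<in> prob_simplex" "\<And>i. 0 < snd z $ i"
  shows "0 \<le> breg Cf z u"
proof -
  have "0 \<le> (norm (fst u - fst z))\<^sup>2 / (2 * Cf\<^sup>2)
      + (norm (snd u - snd z))\<^sup>2 / (8 * ln (real CARD('m)))" using m by simp
  then show ?thesis using breg_ge[OF assms, of Cf] by linarith
qed

lemma prox_step_feasible:
  assumes "0 < Cf" and "\<And>i. 0 < snd z $ i"
  shows "prox_step Cf z \<zeta> \<in> feasible Cf"
  using assms closest_point_in_set[of "cball 0 Cf" "fst z - Cf\<^sup>2 *\<^sub>R fst \<zeta>"]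
    mult_weights_in_prob_simplex[OF assms(2)]
  by (auto simp: feasible_def prox_step_def)

text \<open>By the three-point inequality the prox objective at u exceeds its value at the explicit
  point p by at least \<open>breg Cf p u\<close>, which is positive unless u = p.\<close>

lemma prox_eq_prox_step:
  fixes z \<zeta> :: "(real ^ 'n) \<times> (real ^ 'm)"
  assumes m: "2 \<le> CARD('m)" and Cf: "0 < Cf"
    and z: "snd z \<in> prob_simplex" "\<And>i. 0 < snd z $ i"
  shows "prox Cf z \<zeta> = prox_step Cf z \<zeta>"
  unfolding prox_def
proof (rule arg_min_on_eqI)
  define p where "p = prox_step Cf z \<zeta>"
  show pf: "prox_step Cf z \<zeta> \<in> feasible Cf" by (rule prox_step_feasible[OF Cf z(2)])
  have ppos: "0 < snd p $ i" for i
    using mult_weights_pos[OF z(2)] by (simp add: p_def prox_step_def)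
  fix u :: "(real ^ 'n) \<times> (real ^ 'm)" assume u: "u \<in> feasible Cf" "u \<noteq> prox_step Cf z \<zeta>"
  have su: "snd u \<in> prob_simplex" and sp: "snd p \<in> prob_simplex"
    using u pf by (auto simp: feasible_def p_def)
  have "0 < breg Cf p u"
  proof -
    have "0 < (norm (fst u - fst p))\<^sup>2 / (2 * Cf\<^sup>2)
        + (norm (snd u - snd p))\<^sup>2 / (8 * ln (real CARD('m)))"
      using u(2) m Cf unfolding p_def[symmetric]
      by (cases "fst u = fst p") (auto simp: prod_eq_iff intro!: add_pos_nonneg)
    then show ?thesis using breg_ge[OF m su sp ppos, of Cf] by linarith
  qed
  with prox_step_three_point[OF m Cf z(2) u(1), of \<zeta>]
  show "\<zeta> \<bullet> (prox_step Cf z \<zeta> - z) + bregman Cf z (prox_step Cf z \<zeta>)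
      < \<zeta> \<bullet> (u - z) + bregman Cf z u"
    unfolding p_def[symmetric] bregman_eq_breg[OF z su] bregman_eq_breg[OF z sp]
    by (simp add: inner_diff_right)
qed

text \<open>Young's inequality trades the linear term for the strong convexity of \<^const>\<open>breg\<close>.\<close>

lemma prox_step_progress:
  fixes z u \<zeta> :: "(real ^ 'n) \<times> (real ^ 'm)"
  assumes m: "2 \<le> CARD('m)" and Cf: "0 < Cf"
    and z: "snd z \<in> prob_simplex" "\<And>i. 0 < snd z $ i" and u: "u \<in> feasible Cf"
  shows "\<zeta> \<bullet> (z - u) \<le> breg Cf z u - breg Cf (prox_step Cf z \<zeta>) u
    + Cf\<^sup>2 / 2 * (norm (fst \<zeta>))\<^sup>2 + 2 * ln (real CARD('m)) * (norm (snd \<zeta>))\<^sup>2"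
proof -
  define p where "p = prox_step Cf z \<zeta>"
  define c where "c = ln (real CARD('m))"
  have c: "0 < c" using m by (simp add: c_def)
  have sp: "snd p \<in> prob_simplex"
    using prox_step_feasible[where z=z and \<zeta>=\<zeta>, OF Cf z(2)] by (simp add: feasible_def p_def mem_Times_iff)
  have young: "a \<bullet> b \<le> (norm a)\<^sup>2 * k / 2 + (norm b)\<^sup>2 / (2 * k)" if "0 < k"
    for a b :: "'z::real_inner" and k :: real
  proof -
    have "(norm (k *\<^sub>R a - b))\<^sup>2 = k\<^sup>2 * (norm a)\<^sup>2 - 2 * k * (a \<bullet> b) + (norm b)\<^sup>2"
      unfolding power2_norm_eq_inner
      by (simp add: inner_diff inner_commute power2_eq_square[of k])
    then have "0 \<le> k\<^sup>2 * (norm a)\<^sup>2 - 2 * k * (a \<bullet> b) + (norm b)\<^sup>2"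
      by (metis zero_le_power2)
    then show ?thesis using that by (simp add: field_simps power2_eq_square)
  qed
  have "\<zeta> \<bullet> (z - p) = fst \<zeta> \<bullet> (fst z - fst p) + snd \<zeta> \<bullet> (snd z - snd p)"
    by (simp add: inner_prod_def)
  \<comment> \<open>The parameters \<open>Cf\<^sup>2\<close> and 4c of Young's inequality are chosen
    so that the remaining squares are exactly those in \<open>breg_ge\<close>.\<close>
  also have "\<dots> \<le> Cf\<^sup>2 / 2 * (norm (fst \<zeta>))\<^sup>2 + (norm (fst p - fst z))\<^sup>2 / (2 * Cf\<^sup>2)
      + (2 * c * (norm (snd \<zeta>))\<^sup>2 + (norm (snd p - snd z))\<^sup>2 / (8 * c))"
    using young[of "Cf\<^sup>2" "fst \<zeta>" "fst z - fst p"] young[of "4 * c" "snd \<zeta>" "snd z - snd p"] Cf c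
    by (simp add: norm_minus_commute mult.commute)
  also have "\<dots> \<le> Cf\<^sup>2 / 2 * (norm (fst \<zeta>))\<^sup>2 + 2 * c * (norm (snd \<zeta>))\<^sup>2 + breg Cf z p"
    using breg_ge[OF m sp z, of Cf] unfolding c_def by simp
  finally show ?thesis
    using prox_step_three_point[OF m Cf z(2) u, of \<zeta>]
    unfolding p_def[symmetric] c_def[symmetric] by (simp add: inner_diff_right)
qed

subsection \<open>The inner loop along a fixed sample path\<close>

text \<open>Positivity of the weights has to be carried along with feasibility, because the closed
  form of the prox-mapping is available only at such points.\<close>

lemma inner_iter_invariants:
  fixes G :: "'m::finite \<Rightarrow> real ^ 'n \<Rightarrow> 'e \<Rightarrow> real ^ 'n"
  assumes m: "2 \<le> CARD('m)" and Cf: "0 < Cf"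
  shows "inner_iter G Cf \<gamma> x xs s \<in> feasible Cf \<and> (\<forall>i. 0 < snd (inner_iter G Cf \<gamma> x xs s) $ i)"
proof (induction s)
  case 0
  show ?case using Cf by (simp add: feasible_def prob_simplex_def)
next
  case (Suc s)
  then have sim: "snd (inner_iter G Cf \<gamma> x xs s) \<in> prob_simplex"
    and pos: "\<And>i. 0 < snd (inner_iter G Cf \<gamma> x xs s) $ i"
    by (auto simp: feasible_def mem_Times_iff)
  show ?case
    unfolding inner_iter.simps prox_eq_prox_step[OF m Cf sim pos]
    by (intro conjI allI prox_step_feasible[OF Cf pos]) (simp add: prox_step_def mult_weights_pos[OF pos])
qed

lemma
  fixes G :: "'m::finite \<Rightarrow> real ^ 'n \<Rightarrow> 'e \<Rightarrow> real ^ 'n"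
  assumes "2 \<le> CARD('m)" and "0 < Cf"
  shows inner_iter_feasible: "inner_iter G Cf \<gamma> x xs s \<in> feasible Cf"
    and inner_iter_simplex: "snd (inner_iter G Cf \<gamma> x xs s) \<in> prob_simplex"
    and inner_iter_pos: "0 < snd (inner_iter G Cf \<gamma> x xs s) $ i"
    and inner_iter_norm: "norm (fst (inner_iter G Cf \<gamma> x xs s)) \<le> Cf"
  using inner_iter_invariants[OF assms, of G \<gamma> x xs s] by (auto simp: feasible_def mem_Times_iff)

lemma inner_iter_Suc_prox_step:
  fixes G :: "'m::finite \<Rightarrow> real ^ 'n \<Rightarrow> 'e \<Rightarrow> real ^ 'n"
  assumes "2 \<le> CARD('m)" and "0 < Cf"
  shows "inner_iter G Cf \<gamma> x xs (Suc s) = prox_step Cf (inner_iter G Cf \<gamma> x xs s)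
    (\<gamma> s *\<^sub>R grad_phi (\<lambda>i. G i x (xs s)) (inner_iter G Cf \<gamma> x xs s))"
  unfolding inner_iter.simps
  by (intro prox_eq_prox_step assms inner_iter_simplex inner_iter_pos)

text \<open>Adaptedness: this, and \<open>msmd_cong\<close> for the outer loop, let an iterate be
  written as a function of past samples only, as independence requires.\<close>

lemma inner_iter_cong:
  assumes "\<And>t. t < s \<Longrightarrow> xs t = ys t"
  shows "inner_iter G Cf \<gamma> x xs s = inner_iter G Cf \<gamma> x ys s"
  using assms by (induction s) auto

lemma msmd_cong:
  assumes "\<And>j t. j < k \<Longrightarrow> xs j t = ys j t"
  shows "msmd G Cf r \<gamma> \<alpha> S x0 xs k = msmd G Cf r \<gamma> \<alpha> S x0 ys k"
  using assms
proof (induction k)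
  case (Suc k)
  then have "xs k = ys k" by auto
  with Suc show ?case by simp
qed simp

lemma norm_sq_grad_phi_le:
  fixes g :: "'m::finite \<Rightarrow> real ^ 'n"
  assumes z: "z \<in> feasible Cf"
  shows "(norm (fst (grad_phi g z)))\<^sup>2 \<le> 2 * (\<Sum>i\<in>UNIV. (norm (g i))\<^sup>2) + 2 * Cf\<^sup>2"
    and "(norm (snd (grad_phi g z)))\<^sup>2 \<le> Cf\<^sup>2 * (\<Sum>i\<in>UNIV. (norm (g i))\<^sup>2)"
proof -
  define R where "R = sqrt (\<Sum>i\<in>UNIV. (norm (g i))\<^sup>2)"
  have R: "0 \<le> R" "R\<^sup>2 = (\<Sum>i\<in>UNIV. (norm (g i))\<^sup>2)" by (simp_all add: R_def sum_nonneg)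
  have d: "norm (fst z) \<le> Cf" and l: "snd z \<in> prob_simplex"
    using z by (auto simp: feasible_def mem_Times_iff)
  have "norm (g i) \<le> R" for i
    unfolding R_def by (intro real_le_rsqrt member_le_sum) auto
  then have "(\<Sum>i\<in>UNIV. snd z $ i * norm (g i)) \<le> R"
    by (intro convex_combination_le[OF l])
  moreover have "norm (\<Sum>i\<in>UNIV. snd z $ i *\<^sub>R g i) \<le> (\<Sum>i\<in>UNIV. snd z $ i * norm (g i))"
    using prob_simplex_nonneg[OF l] by (intro order.trans[OF norm_sum]) simp
  ultimately have "norm (fst (grad_phi g z)) \<le> R + Cf"
    using d by (auto simp: grad_phi_def intro: norm_triangle_le)
  then have "(norm (fst (grad_phi g z)))\<^sup>2 \<le> (R + Cf)\<^sup>2" by (intro power_mono) auto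
  also have "\<dots> \<le> 2 * R\<^sup>2 + 2 * Cf\<^sup>2"
    using sum_squares_ge_zero[of "R - Cf" 0] by (simp add: power2_eq_square algebra_simps)
  finally show "(norm (fst (grad_phi g z)))\<^sup>2 \<le> 2 * (\<Sum>i\<in>UNIV. (norm (g i))\<^sup>2) + 2 * Cf\<^sup>2"
    by (simp only: R)
  have "(norm (snd (grad_phi g z)))\<^sup>2 = (\<Sum>i\<in>UNIV. (g i \<bullet> fst z)\<^sup>2)"
    by (simp add: grad_phi_def norm_vec_def L2_set_def sum_nonneg)
  also have "\<dots> \<le> (\<Sum>i\<in>UNIV. Cf\<^sup>2 * (norm (g i))\<^sup>2)"
  proof (rule sum_mono)
    fix i
    have "\<bar>g i \<bullet> fst z\<bar> \<le> norm (g i) * Cf"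
      using Cauchy_Schwarz_ineq2[of "g i" "fst z"] d
      by (meson mult_left_mono norm_ge_zero order.trans)
    from power_mono[OF this, of 2] show "(g i \<bullet> fst z)\<^sup>2 \<le> Cf\<^sup>2 * (norm (g i))\<^sup>2"
      by (simp add: power_mult_distrib mult.commute)
  qed
  finally show "(norm (snd (grad_phi g z)))\<^sup>2 \<le> Cf\<^sup>2 * (\<Sum>i\<in>UNIV. (norm (g i))\<^sup>2)"
    by (simp add: sum_distrib_left)
qed

text \<open>The terms bilinear in the direction and the weights of z cancel by skew-symmetry. What
  remains is affine in the sampled gradients, so that they can be replaced by their means under
  expectation.\<close>

lemma grad_phi_inner_diff:
  "grad_phi g z \<bullet> (z - (ds, ls)) =
    (\<Sum>i\<in>UNIV. g i \<bullet> (ls $ i *\<^sub>R fst z - snd z $ i *\<^sub>R ds)) + fst z \<bullet> (fst z - ds)"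
proof -
  have "grad_phi g z \<bullet> (z - (ds, ls)) =
      (\<Sum>i\<in>UNIV. snd z $ i * (g i \<bullet> (fst z - ds))) + fst z \<bullet> (fst z - ds)
      - (\<Sum>i\<in>UNIV. (g i \<bullet> fst z) * (snd z $ i - ls $ i))"
    by (simp add: grad_phi_def inner_prod_def inner_vec_def[where 'b = 'b] inner_add_left
        inner_sum_left sum_negf)
  also have "\<dots> = (\<Sum>i\<in>UNIV. g i \<bullet> (ls $ i *\<^sub>R fst z - snd z $ i *\<^sub>R ds)) + fst z \<bullet> (fst z - ds)"
    by (simp add: inner_diff_right sum_subtractf right_diff_distrib mult.commute)
  finally show ?thesis .
qed

text \<open>Pathwise bound on the second-order term of \<open>prox_step_progress\<close>; it is
  still random through the sampled gradients and is integrated in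
  \<open>integral_noise_bound\<close>.\<close>

definition noise_bound :: "real \<Rightarrow> ('m::finite \<Rightarrow> real ^ 'n) \<Rightarrow> real" where
  "noise_bound Cf g =
     Cf\<^sup>2 * (1 + 2 * ln (real CARD('m))) * (\<Sum>i\<in>UNIV. (norm (g i))\<^sup>2) + Cf ^ 4"

lemma inner_iter_progress:
  fixes G :: "'m::finite \<Rightarrow> real ^ 'n \<Rightarrow> 'e \<Rightarrow> real ^ 'n" and \<gamma> x xs
  assumes m: "2 \<le> CARD('m)" and Cf: "0 < Cf" and u: "u \<in> feasible Cf"
  defines "z \<equiv> inner_iter G Cf \<gamma> x xs"
  shows "\<gamma> s * (grad_phi (\<lambda>i. G i x (xs s)) (z s) \<bullet> (z s - u))
    \<le> breg Cf (z s) u - breg Cf (z (Suc s)) u + (\<gamma> s)\<^sup>2 * noise_bound Cf (\<lambda>i. G i x (xs s))"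
proof -
  define g where "g i = G i x (xs s)" for i
  define F where "F = grad_phi g (z s)"
  have z: "snd (z s) \<in> prob_simplex" "\<And>i. 0 < snd (z s) $ i" "z s \<in> feasible Cf"
    unfolding z_def
    by (intro inner_iter_simplex inner_iter_pos inner_iter_feasible m Cf)+
  have zS: "z (Suc s) = prox_step Cf (z s) (\<gamma> s *\<^sub>R F)"
    unfolding z_def inner_iter_Suc_prox_step[OF m Cf] F_def g_def ..
  have "Cf\<^sup>2 / 2 * (norm (fst F))\<^sup>2 + 2 * ln (real CARD('m)) * (norm (snd F))\<^sup>2
      \<le> Cf\<^sup>2 / 2 * (2 * (\<Sum>i\<in>UNIV. (norm (g i))\<^sup>2) + 2 * Cf\<^sup>2)
        + 2 * ln (real CARD('m)) * (Cf\<^sup>2 * (\<Sum>i\<in>UNIV. (norm (g i))\<^sup>2))"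
    unfolding F_def using m
    by (intro add_mono mult_left_mono norm_sq_grad_phi_le[OF z(3)]) auto
  also have "\<dots> = noise_bound Cf g"
    by (simp add: noise_bound_def algebra_simps power2_eq_square power4_eq_xxxx)
  finally have "(\<gamma> s)\<^sup>2 * (Cf\<^sup>2 / 2 * (norm (fst F))\<^sup>2 + 2 * ln (real CARD('m)) * (norm (snd F))\<^sup>2)
      \<le> (\<gamma> s)\<^sup>2 * noise_bound Cf g"
    by (intro mult_left_mono) auto
  with prox_step_progress[OF m Cf z(1,2) u, of "\<gamma> s *\<^sub>R F"]
  show ?thesis
    unfolding zS[symmetric] g_def[symmetric] F_def[symmetric]
    by (simp add: power_mult_distrib algebra_simps)
qed

lemma inner_iter_regret:
  fixes G :: "'m::finite \<Rightarrow> real ^ 'n \<Rightarrow> 'e \<Rightarrow> real ^ 'n" and \<gamma> x xs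
  assumes m: "2 \<le> CARD('m)" and Cf: "0 < Cf" and u: "u \<in> feasible Cf"
  defines "z \<equiv> inner_iter G Cf \<gamma> x xs"
  shows "(\<Sum>s<T. \<gamma> s * (grad_phi (\<lambda>i. G i x (xs s)) (z s) \<bullet> (z s - u)))
    \<le> 1 + (\<Sum>s<T. (\<gamma> s)\<^sup>2 * noise_bound Cf (\<lambda>i. G i x (xs s)))"
proof -
  have "(\<Sum>s<T. \<gamma> s * (grad_phi (\<lambda>i. G i x (xs s)) (z s) \<bullet> (z s - u)))
      \<le> (\<Sum>s<T. breg Cf (z s) u - breg Cf (z (Suc s)) u
          + (\<gamma> s)\<^sup>2 * noise_bound Cf (\<lambda>i. G i x (xs s)))"
    unfolding z_def by (intro sum_mono inner_iter_progress[OF m Cf u])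
  also have "\<dots> = breg Cf (z 0) u - breg Cf (z T) u
      + (\<Sum>s<T. (\<gamma> s)\<^sup>2 * noise_bound Cf (\<lambda>i. G i x (xs s)))"
    using sum_lessThan_telescope'[of "\<lambda>s. breg Cf (z s) u" T] by (simp add: sum.distrib)
  \<comment> \<open>Each half contributes 1/2: the loop starts at direction 0 with u in the ball of
    radius \<open>Cf\<close>, and at uniform weights, where the divergence ln m is divided by 2 ln
    m.\<close>
  also have "breg Cf (z 0) u - breg Cf (z T) u \<le> 1"
  proof -
    have u': "norm (fst u) \<le> Cf" "snd u \<in> prob_simplex"
      using u by (auto simp: feasible_def mem_Times_iff)
    have "0 \<le> breg Cf (z T) u"
      unfolding z_def
      by (intro breg_nonneg m u' inner_iter_simplex[OF m Cf] inner_iter_pos[OF m Cf])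
    moreover have "(norm (fst u))\<^sup>2 / (2 * Cf\<^sup>2) \<le> 1 / 2"
      using power_mono[OF u'(1), of 2] Cf by (simp add: field_simps)
    moreover have "kl (snd u) (\<chi> i. 1 / real CARD('m)) / (2 * ln (real CARD('m))) \<le> 1 / 2"
      using kl_uniform_le[OF u'(2)] m by (simp add: field_simps)
    ultimately show ?thesis by (simp add: breg_def z_def)
  qed
  finally show ?thesis by simp
qed

lemma averaged_fst: "fst (averaged r \<gamma> S z) = averaged r \<gamma> S (\<lambda>s. fst (z s))"
  by (simp add: averaged_def fst_sum)

text \<open>The arithmetic-geometric mean inequality turns the bound on squared distances that the
  regret provides into one on the distance, at the price of the free parameter \<open>e\<close>.\<close>

lemma norm_averaged_diff_le:
  fixes d :: "nat \<Rightarrow> 'a::real_normed_vector"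
  assumes \<gamma>: "\<And>s. 0 < \<gamma> s" and PS: "avg_start r S \<le> S" and e: "0 < e"
  shows "norm (averaged r \<gamma> S d - v) \<le> e / 2
    + (\<Sum>s\<le>S. \<gamma> s * (norm (d s - v))\<^sup>2) / (2 * e * (\<Sum>s = avg_start r S..S. \<gamma> s))"
proof -
  define A where "A = {avg_start r S..S}"
  define W where "W = sum \<gamma> A"
  have W: "0 < W" unfolding W_def A_def using PS \<gamma> by (intro sum_pos) auto
  have "averaged r \<gamma> S d - v = (1 / W) *\<^sub>R (\<Sum>s\<in>A. \<gamma> s *\<^sub>R (d s - v))"
    using W by (simp add: averaged_def A_def[symmetric] W_def[symmetric] scaleR_diff_right
        sum_subtractf flip: scaleR_sum_left)
  then have "norm (averaged r \<gamma> S d - v) = norm (\<Sum>s\<in>A. \<gamma> s *\<^sub>R (d s - v)) / W"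
    using W by simp
  also have "\<dots> \<le> (\<Sum>s\<in>A. \<gamma> s * norm (d s - v)) / W"
    using W \<gamma> by (intro divide_right_mono order.trans[OF norm_sum]) (auto simp: less_imp_le)
  also have "\<dots> \<le> (\<Sum>s\<in>A. \<gamma> s * (e / 2 + (norm (d s - v))\<^sup>2 / (2 * e))) / W"
  proof (intro divide_right_mono sum_mono mult_left_mono)
    fix s
    have "0 \<le> (e - norm (d s - v))\<^sup>2" by simp
    then show "norm (d s - v) \<le> e / 2 + (norm (d s - v))\<^sup>2 / (2 * e)"
      using e by (simp add: power2_eq_square field_simps)
  qed (use W \<gamma> in \<open>auto simp: less_imp_le\<close>)
  also have "\<dots> = e / 2 + (\<Sum>s\<in>A. \<gamma> s * (norm (d s - v))\<^sup>2) / (2 * e * W)"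
    using W e by (simp add: W_def[symmetric] distrib_left sum.distrib add_divide_distrib
        flip: sum_distrib_right sum_divide_distrib)
  \<comment> \<open>The window is enlarged to all steps, because the regret bound with a controlled
    starting distance is the one from step 0.\<close>
  also have "\<dots> \<le> e / 2 + (\<Sum>s\<le>S. \<gamma> s * (norm (d s - v))\<^sup>2) / (2 * e * W)"
    using W e \<gamma> by (intro add_left_mono divide_right_mono sum_mono2)
      (auto simp: A_def less_imp_le)
  finally show ?thesis by (simp add: W_def A_def)
qed

subsection \<open>Measurability\<close>

lemma borel_measurable_vec_lambda:
  fixes f :: "'m::finite \<Rightarrow> 'a \<Rightarrow> real"
  assumes "\<And>i. f i \<in> borel_measurable A"
  shows "(\<lambda>a. \<chi> i. f i a) \<in> borel_measurable A"
  using assms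
  by (subst borel_measurable_euclidean_space) (auto simp: Basis_vec_def inner_axis)

lemma borel_measurable_vec_nth:
  assumes "f \<in> borel_measurable A"
  shows "(\<lambda>a. f a $ i :: real) \<in> borel_measurable A"
  by (rule borel_measurable_continuous_on[OF _ assms]) (intro continuous_intros)

lemma borel_measurable_fst_comp:
  fixes f :: "'a \<Rightarrow> 'b::second_countable_topology \<times> 'c::second_countable_topology"
  assumes "f \<in> borel_measurable A"
  shows "(\<lambda>a. fst (f a)) \<in> borel_measurable A"
  by (rule borel_measurable_continuous_on[OF _ assms]) (intro continuous_intros)

lemma borel_measurable_snd_comp:
  fixes f :: "'a \<Rightarrow> 'b::second_countable_topology \<times> 'c::second_countable_topology"
  assumes "f \<in> borel_measurable A"
  shows "(\<lambda>a. snd (f a)) \<in> borel_measurable A"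
  by (rule borel_measurable_continuous_on[OF _ assms]) (intro continuous_intros)

text \<open>The closed form makes this accessible: the projection onto the ball is continuous and
  the weights are an elementary expression.\<close>

lemma borel_measurable_prox_step:
  fixes z \<zeta> :: "'a \<Rightarrow> (real ^ 'n) \<times> (real ^ 'm)"
  assumes Cf: "0 \<le> Cf" and [measurable]: "z \<in> borel_measurable A" "\<zeta> \<in> borel_measurable A"
  shows "(\<lambda>a. prox_step Cf (z a) (\<zeta> a)) \<in> borel_measurable A"
proof -
  note [measurable] = borel_measurable_fst_comp borel_measurable_snd_comp borel_measurable_vec_nth
  have "(\<lambda>a. closest_point (cball 0 Cf) (fst (z a) - Cf\<^sup>2 *\<^sub>R fst (\<zeta> a))) \<in> borel_measurable A"
    using Cf
    by (intro borel_measurable_continuous_on[OF continuous_on_closest_point]) auto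
  then show ?thesis
    unfolding prox_step_def mult_weights_def
    by (intro borel_measurable_Pair borel_measurable_vec_lambda) simp_all
qed

text \<open>Measurability is asked only of the samples before step s, so that the lemma applies on a
  product space carrying just those coordinates.\<close>

lemma borel_measurable_inner_iter:
  fixes G :: "'m::finite \<Rightarrow> real ^ 'n \<Rightarrow> 'e \<Rightarrow> real ^ 'n"
  assumes m: "2 \<le> CARD('m)" and Cf: "0 < Cf"
    and G: "\<And>i. (\<lambda>(x, e). G i x e) \<in> borel \<Otimes>\<^sub>M N \<rightarrow>\<^sub>M borel"
    and X: "X \<in> borel_measurable A" and Y: "\<And>t. t < s \<Longrightarrow> Y t \<in> A \<rightarrow>\<^sub>M N"
  shows "(\<lambda>a. inner_iter G Cf \<gamma> (X a) (\<lambda>t. Y t a) s) \<in> borel_measurable A"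
  using Y
proof (induction s)
  case 0
  show ?case by simp
next
  case (Suc s)
  have Z[measurable]: "(\<lambda>a. inner_iter G Cf \<gamma> (X a) (\<lambda>t. Y t a) s) \<in> borel_measurable A"
    by (rule Suc.IH) (simp add: Suc.prems)
  have GY[measurable]: "(\<lambda>a. G i (X a) (Y s a)) \<in> borel_measurable A" for i
    using measurable_compose[OF measurable_Pair[OF X Suc.prems[of s]] G[of i]] by simp
  note [measurable] = borel_measurable_fst_comp borel_measurable_snd_comp borel_measurable_vec_nth
  have "(\<lambda>a. grad_phi (\<lambda>i. G i (X a) (Y s a)) (inner_iter G Cf \<gamma> (X a) (\<lambda>t. Y t a) s))
      \<in> borel_measurable A"
    unfolding grad_phi_def
    by (intro borel_measurable_Pair borel_measurable_uminus borel_measurable_vec_lambda) measurable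
  then show ?case
    unfolding inner_iter_Suc_prox_step[OF m Cf]
    using Cf by (intro borel_measurable_prox_step Z borel_measurable_scaleR) auto
qed

lemma borel_measurable_averaged_direction:
  fixes G :: "'m::finite \<Rightarrow> real ^ 'n \<Rightarrow> 'e \<Rightarrow> real ^ 'n"
  assumes m: "2 \<le> CARD('m)" and Cf: "0 < Cf"
    and G: "\<And>i. (\<lambda>(x, e). G i x e) \<in> borel \<Otimes>\<^sub>M N \<rightarrow>\<^sub>M borel"
    and X: "X \<in> borel_measurable A" and Y: "\<And>t. Y t \<in> A \<rightarrow>\<^sub>M N"
  shows "(\<lambda>a. fst (averaged r \<gamma> S (inner_iter G Cf \<gamma> (X a) (\<lambda>t. Y t a)))) \<in> borel_measurable A"
  unfolding averaged_fst averaged_def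
  by (intro borel_measurable_scaleR borel_measurable_const borel_measurable_sum
      borel_measurable_fst_comp borel_measurable_inner_iter[OF m Cf G X Y])

lemma borel_measurable_msmd:
  fixes G :: "'m::finite \<Rightarrow> real ^ 'n \<Rightarrow> 'e \<Rightarrow> real ^ 'n"
  assumes m: "2 \<le> CARD('m)" and Cf: "0 < Cf"
    and G: "\<And>i. (\<lambda>(x, e). G i x e) \<in> borel \<Otimes>\<^sub>M N \<rightarrow>\<^sub>M borel"
    and Y: "\<And>j t. j < k \<Longrightarrow> Y j t \<in> A \<rightarrow>\<^sub>M N"
  shows "(\<lambda>a. msmd G Cf r \<gamma> \<alpha> S x0 (\<lambda>j t. Y j t a) k) \<in> borel_measurable A"
  using Y
proof (induction k)
  case (Suc k)
  have "(\<lambda>a. msmd G Cf r \<gamma> \<alpha> S x0 (\<lambda>j t. Y j t a) k) \<in> borel_measurable A"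
    by (rule Suc.IH) (simp add: Suc.prems)
  then show ?case
    unfolding msmd.simps using Suc.prems[of k]
    by (intro borel_measurable_add borel_measurable_scaleR borel_measurable_const
        borel_measurable_averaged_direction[OF m Cf G]) auto
qed simp

text \<open>Continuity follows from \<open>dist_descent_dir_le\<close> once the norm of the
  direction at y is replaced by that of a gradient, which is already known to be continuous in
  y.\<close>

lemma borel_measurable_descent_dir:
  assumes lip: "\<And>i. L-lipschitz_on UNIV (grad (f i))"
  shows "descent_dir f \<in> borel_measurable borel"
proof (rule borel_measurable_continuous_onI, unfold continuous_on_eq_continuous_at[OF open_UNIV], rule ballI)
  fix x
  define D where "D = descent_dir f"
  define i where "i = (undefined :: 'a)"
  have cont: "continuous (at x) (grad (f i))"
    using lipschitz_on_continuous_on[OF lip[of i]] by (simp add: continuous_on_eq_continuous_at)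
  have L: "0 \<le> L" using lip[of i] by (rule lipschitz_on_nonneg)
  have "((\<lambda>y. sqrt (L * dist y x * (norm (D x) + norm (grad (f i) y)))) \<longlongrightarrow>
      sqrt (L * dist x x * (norm (D x) + norm (grad (f i) x)))) (at x)"
    using cont unfolding continuous_at by (intro tendsto_intros)
  then have lim: "((\<lambda>y. sqrt (L * dist y x * (norm (D x) + norm (grad (f i) y)))) \<longlongrightarrow> 0) (at x)"
    by simp
  have "dist (D y) (D x) \<le> sqrt (L * dist y x * (norm (D x) + norm (grad (f i) y)))" for y
  proof (rule real_le_rsqrt)
    have "(dist (D y) (D x))\<^sup>2 \<le> L * dist y x * (norm (D x) + norm (D y))"
      unfolding D_def by (rule dist_descent_dir_le[OF lip])
    also have "\<dots> \<le> L * dist y x * (norm (D x) + norm (grad (f i) y))"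
      using L norm_descent_dir_le[of f y i] by (intro mult_left_mono) (auto simp: D_def)
    finally show "(dist (D y) (D x))\<^sup>2 \<le> L * dist y x * (norm (D x) + norm (grad (f i) y))" .
  qed
  then have "((\<lambda>y. dist (D y) (D x)) \<longlongrightarrow> 0) (at x)"
    by (intro tendsto_sandwich[OF _ _ tendsto_const lim]) auto
  then show "continuous (at x) (descent_dir f)"
    unfolding continuous_at D_def by (rule tendsto_dist_iff[THEN iffD2])
qed

lemma norm_averaged_le:
  fixes d :: "nat \<Rightarrow> 'a::real_normed_vector"
  assumes \<gamma>: "\<And>s. 0 < \<gamma> s" and PS: "avg_start r S \<le> S" and d: "\<And>s. norm (d s) \<le> C"
  shows "norm (averaged r \<gamma> S d) \<le> C"
proof -
  define A where "A = {avg_start r S..S}"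
  have W: "0 < sum \<gamma> A" unfolding A_def using PS \<gamma> by (intro sum_pos) auto
  have "norm (\<Sum>s\<in>A. \<gamma> s *\<^sub>R d s) \<le> (\<Sum>s\<in>A. \<gamma> s * C)"
    using \<gamma> d by (intro order.trans[OF norm_sum] sum_mono) (auto simp: less_imp_le)
  also have "\<dots> = sum \<gamma> A * C" by (simp add: sum_distrib_right)
  finally show ?thesis
    using W by (simp add: averaged_def A_def[symmetric] field_simps)
qed

subsection \<open>Independence\<close>

context prob_space
begin

lemma integrable_bounded:
  fixes h :: "'a \<Rightarrow> 'b::{banach, second_countable_topology}"
  assumes "h \<in> borel_measurable M" and "\<And>w. norm (h w) \<le> C"
  shows "integrable M h"
  using assms by (intro integrable_const_bound[of _ C]) auto

text \<open>Freezing: the joint law is a product, so Tonelli allows X to be held fixed while Y is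
  drawn afresh. Estimates at a fixed point thereby carry over to a random iterate, with no
  integrability to check.\<close>

lemma nn_integral_indep_var:
  assumes ind: "indep_var A X B Y" and h: "h \<in> borel_measurable (A \<Otimes>\<^sub>M B)"
  shows "(\<integral>\<^sup>+w. h (X w, Y w) \<partial>M) = (\<integral>\<^sup>+w. \<integral>\<^sup>+w'. h (X w, Y w') \<partial>M \<partial>M)"
proof -
  have [measurable]: "X \<in> M \<rightarrow>\<^sub>M A" "Y \<in> M \<rightarrow>\<^sub>M B"
    and D: "distr M (A \<Otimes>\<^sub>M B) (\<lambda>w. (X w, Y w)) = distr M A X \<Otimes>\<^sub>M distr M B Y"
    using ind by (auto simp: indep_var_distribution_eq)
  note h[measurable]
  interpret Y: prob_space "distr M B Y" by (rule prob_space_distr) simp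
  have "(\<integral>\<^sup>+w. h (X w, Y w) \<partial>M) = (\<integral>\<^sup>+p. h p \<partial>distr M (A \<Otimes>\<^sub>M B) (\<lambda>w. (X w, Y w)))"
    by (rule nn_integral_distr[symmetric]) measurable
  also have "\<dots> = (\<integral>\<^sup>+p. h p \<partial>(distr M A X \<Otimes>\<^sub>M distr M B Y))"
    by (simp only: D)
  also have "\<dots> = (\<integral>\<^sup>+x. \<integral>\<^sup>+y. h (x, y) \<partial>distr M B Y \<partial>distr M A X)"
    by (rule Y.nn_integral_fst[symmetric]) measurable
  also have "\<dots> = (\<integral>\<^sup>+w. \<integral>\<^sup>+y. h (X w, y) \<partial>distr M B Y \<partial>M)"
    by (rule nn_integral_distr) measurable
  also have "\<dots> = (\<integral>\<^sup>+w. \<integral>\<^sup>+w'. h (X w, Y w') \<partial>M \<partial>M)"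
  proof (rule nn_integral_cong)
    fix w assume "w \<in> space M"
    then have [measurable]: "X w \<in> space A" by (rule measurable_space[OF \<open>X \<in> M \<rightarrow>\<^sub>M A\<close>])
    show "(\<integral>\<^sup>+y. h (X w, y) \<partial>distr M B Y) = (\<integral>\<^sup>+w'. h (X w, Y w') \<partial>M)"
      by (rule nn_integral_distr) measurable
  qed
  finally show ?thesis .
qed

text \<open>The scalar product rule for independent variables, applied to each coordinate.\<close>

lemma
  fixes X Y :: "'a \<Rightarrow> 'b::euclidean_space"
  assumes ind: "indep_var borel X borel Y" and X: "integrable M X" and Y: "integrable M Y"
  shows integrable_inner_indep_var: "integrable M (\<lambda>w. X w \<bullet> Y w)"
    and integral_inner_indep_var: "(\<integral>w. X w \<bullet> Y w \<partial>M) = (\<integral>w. X w \<partial>M) \<bullet> (\<integral>w. Y w \<partial>M)"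
proof -
  have ind': "indep_var borel (\<lambda>w. X w \<bullet> b) borel (\<lambda>w. Y w \<bullet> b)" for b
    using indep_var_compose[OF ind, of "\<lambda>x. x \<bullet> b" borel "\<lambda>x. x \<bullet> b" borel] by (simp add: comp_def)
  have int: "integrable M (\<lambda>w. (X w \<bullet> b) * (Y w \<bullet> b))" for b
    by (intro indep_var_integrable[OF ind'] integrable_inner_left X Y)
  have eq: "(\<integral>w. (X w \<bullet> b) * (Y w \<bullet> b) \<partial>M) = ((\<integral>w. X w \<partial>M) \<bullet> b) * ((\<integral>w. Y w \<partial>M) \<bullet> b)" for b
    using indep_var_lebesgue_integral[OF ind'] X Y by simp
  have expand: "(\<lambda>w. X w \<bullet> Y w) = (\<lambda>w. \<Sum>b\<in>Basis. (X w \<bullet> b) * (Y w \<bullet> b))"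
    by (intro ext euclidean_inner)
  show "integrable M (\<lambda>w. X w \<bullet> Y w)"
    unfolding expand by (intro Bochner_Integration.integrable_sum int)
  have "(\<integral>w. X w \<bullet> Y w \<partial>M) = (\<Sum>b\<in>Basis. ((\<integral>w. X w \<partial>M) \<bullet> b) * ((\<integral>w. Y w \<partial>M) \<bullet> b))"
    unfolding expand by (simp add: Bochner_Integration.integral_sum[OF int] eq)
  also have "\<dots> = (\<integral>w. X w \<partial>M) \<bullet> (\<integral>w. Y w \<partial>M)"
    by (rule euclidean_inner[symmetric])
  finally show "(\<integral>w. X w \<bullet> Y w \<partial>M) = (\<integral>w. X w \<partial>M) \<bullet> (\<integral>w. Y w \<partial>M)" .
qed

end

section \<open>Moments of the stochastic gradients\<close>

lemma stochastic_gradient_atD: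
  fixes f :: "'m::finite \<Rightarrow> real ^ 'n \<Rightarrow> real"
  assumes sg: "stochastic_gradient_at f G N Cf \<delta> x"
  shows "integrable N (G i x)" and "(\<integral>e. G i x e \<partial>N) = grad (f i) x"
    and "integrable N (\<lambda>e. (norm (G i x e))\<^sup>2)" and "(\<integral>e. (norm (G i x e))\<^sup>2 \<partial>N) \<le> Cf\<^sup>2"
proof -
  have hb: "has_bochner_integral N (G i x) (grad (f i) x)"
    and nn: "(\<integral>\<^sup>+e. ennreal ((norm (G i x e))\<^sup>2) \<partial>N) \<le> ennreal (Cf\<^sup>2)"
    using sg by (auto simp: stochastic_gradient_at_def)
  show "integrable N (G i x)" "(\<integral>e. G i x e \<partial>N) = grad (f i) x"
    using hb by (auto simp: has_bochner_integral_iff)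
  then have [measurable]: "G i x \<in> borel_measurable N" by auto
  show "integrable N (\<lambda>e. (norm (G i x e))\<^sup>2)"
    using le_less_trans[OF nn ennreal_less_top] by (intro integrableI_bounded) auto
  show "(\<integral>e. (norm (G i x e))\<^sup>2 \<partial>N) \<le> Cf\<^sup>2"
    using nn by (intro integral_real_bounded) auto
qed

text \<open>Jensen's inequality in elementary form: |g|^2 is the mean of the inner product of g with
  its sample, which is at most |g|^2/2 plus half the squared norm of the sample.\<close>

lemma norm_grad_le:
  fixes f :: "'m::finite \<Rightarrow> real ^ 'n \<Rightarrow> real"
  assumes "prob_space N" and Cf: "0 < Cf" and sg: "stochastic_gradient_at f G N Cf \<delta> x"
  shows "norm (grad (f i) x) \<le> Cf"
proof -
  interpret N: prob_space N by fact
  define g where "g = grad (f i) x"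
  note D = stochastic_gradient_atD[OF sg, of i]
  have "(norm g)\<^sup>2 = (\<integral>e. g \<bullet> G i x e \<partial>N)"
    unfolding integral_inner_right[OF D(1)] D(2) g_def power2_norm_eq_inner ..
  also have "\<dots> \<le> (\<integral>e. (norm g)\<^sup>2 / 2 + (norm (G i x e))\<^sup>2 / 2 \<partial>N)"
  proof (rule integral_mono)
    fix e
    show "g \<bullet> G i x e \<le> (norm g)\<^sup>2 / 2 + (norm (G i x e))\<^sup>2 / 2"
      using dot_norm_neg[of g "G i x e"] zero_le_power2[of "norm (g - G i x e)"] by argo
  qed (use D(1,3) in auto)
  also have "\<dots> = (norm g)\<^sup>2 / 2 + (\<integral>e. (norm (G i x e))\<^sup>2 \<partial>N) / 2"
    using D(3) N.prob_space by simp
  finally have "(norm g)\<^sup>2 \<le> Cf\<^sup>2" using D(4) by simp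
  then have "norm g \<le> Cf" using Cf by (simp add: abs_le_square_iff[symmetric])
  then show ?thesis unfolding g_def .
qed

section \<open>Expected regret of the inner loop at a fixed point\<close>

locale gradient_sampling = prob_space M
  for M :: "'w measure" +
  fixes G :: "'m::finite \<Rightarrow> real ^ 'n \<Rightarrow> 'e \<Rightarrow> real ^ 'n"
    and N :: "'e measure"
    and \<xi> :: "nat \<Rightarrow> nat \<Rightarrow> 'w \<Rightarrow> 'e"
    and Cf :: real
  assumes m: "2 \<le> CARD('m)" and Cf: "0 < Cf"
    and N: "prob_space N"
    and G_meas: "\<And>i. (\<lambda>(x, e). G i x e) \<in> borel \<Otimes>\<^sub>M N \<rightarrow>\<^sub>M borel"
    and indep: "indep_vars (\<lambda>_. N) (\<lambda>(k, s). \<xi> k s) UNIV"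
    and law: "\<And>k s. distr M N (\<xi> k s) = N"
begin

lemma sample_measurable[measurable]: "\<xi> k s \<in> M \<rightarrow>\<^sub>M N"
proof -
  have "\<forall>j\<in>UNIV. (case j of (k, s) \<Rightarrow> \<xi> k s) \<in> M \<rightarrow>\<^sub>M N"
    using indep unfolding indep_vars_def by blast
  from bspec[OF this, of "(k, s)"] show ?thesis by simp
qed

text \<open>Points of the product space \<open>PiM I\<close> are undefined outside \<open>I\<close>,
  hence the restriction.\<close>

abbreviation samples_on :: "(nat \<times> nat) set \<Rightarrow> 'w \<Rightarrow> nat \<times> nat \<Rightarrow> 'e" where
  "samples_on I w \<equiv> restrict (\<lambda>j. \<xi> (fst j) (snd j) w) I"

lemma indep_var_samples_on:
  assumes "I \<inter> J = {}"
    and "F \<in> PiM I (\<lambda>_. N) \<rightarrow>\<^sub>M A" and "H \<in> PiM J (\<lambda>_. N) \<rightarrow>\<^sub>M B"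
  shows "indep_var A (\<lambda>w. F (samples_on I w)) B (\<lambda>w. H (samples_on J w))"
  using indep_var_compose[OF indep_var_restrict[OF indep assms(1)] assms(2,3)]
  by (simp add: comp_def case_prod_beta)

lemma
  fixes h :: "'e \<Rightarrow> 'b::{banach, second_countable_topology}"
  assumes h: "integrable N h"
  shows integrable_sample: "integrable M (\<lambda>w. h (\<xi> k s w))"
    and integral_sample: "(\<integral>w. h (\<xi> k s w) \<partial>M) = (\<integral>e. h e \<partial>N)"
proof -
  have [measurable]: "h \<in> borel_measurable N" using h by auto
  show "integrable M (\<lambda>w. h (\<xi> k s w))"
    using integrable_distr_eq[of "\<xi> k s" M N h] h by (simp add: law)
  show "(\<integral>w. h (\<xi> k s w) \<partial>M) = (\<integral>e. h e \<partial>N)"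
    using integral_distr[of "\<xi> k s" M N h] by (simp add: law)
qed

lemma G_fixed_point_measurable[measurable]: "G i x \<in> borel_measurable N"
  using measurable_compose[OF measurable_Pair1'[of x borel N] G_meas[of i]] by simp

lemma inner_iter_measurable[measurable]:
  "(\<lambda>w. inner_iter G Cf \<gamma> x (\<lambda>s. \<xi> k s w) s) \<in> borel_measurable M"
  by (intro borel_measurable_inner_iter[OF m Cf G_meas]) auto

text \<open>Iterate s is a function of the samples before s, a block of indices disjoint from (k,
  s). Restricting to that block does not change it, by \<open>inner_iter_cong\<close>.\<close>

lemma indep_var_sample_inner_iter:
  fixes h :: "'e \<Rightarrow> 'b::topological_space"
  assumes h: "h \<in> borel_measurable N" and Y: "Y \<in> borel_measurable borel"
  shows "indep_var borel (\<lambda>w. h (\<xi> k s w))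
    borel (\<lambda>w. Y (inner_iter G Cf \<gamma> x (\<lambda>s. \<xi> k s w) s))"
proof -
  define I where "I = {k} \<times> {..<s}"
  define F where "F \<eta> = Y (inner_iter G Cf \<gamma> x (\<lambda>t. \<eta> (k, t)) s)" for \<eta>
  have "F \<in> PiM I (\<lambda>_. N) \<rightarrow>\<^sub>M borel"
    unfolding F_def
    by (rule measurable_compose[OF borel_measurable_inner_iter[OF m Cf G_meas] Y])
       (auto simp: I_def intro!: measurable_component_singleton)
  moreover have "(\<lambda>\<eta>. h (\<eta> (k, s))) \<in> PiM {(k, s)} (\<lambda>_. N) \<rightarrow>\<^sub>M borel"
    using measurable_compose[OF measurable_component_singleton[of "(k, s)" _ "\<lambda>_. N"] h] by simp
  ultimately have "indep_var borel (\<lambda>w. h (samples_on {(k, s)} w (k, s))) borel (\<lambda>w. F (samples_on I w))"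
    by (intro indep_var_samples_on) (auto simp: I_def)
  moreover have "F (samples_on I w) = Y (inner_iter G Cf \<gamma> x (\<lambda>s. \<xi> k s w) s)" for w
    unfolding F_def by (intro arg_cong[of _ _ Y] inner_iter_cong) (simp add: I_def)
  ultimately show ?thesis by simp
qed

lemma integral_noise_bound:
  assumes sg: "stochastic_gradient_at f G N Cf \<delta> x"
  defines "B \<equiv> Cf\<^sup>2 * (1 + 2 * ln (real CARD('m))) * (real CARD('m) * Cf\<^sup>2) + Cf ^ 4"
  shows "integrable M (\<lambda>w. noise_bound Cf (\<lambda>i. G i x (\<xi> k s w)))"
    and "(\<integral>w. noise_bound Cf (\<lambda>i. G i x (\<xi> k s w)) \<partial>M) \<le> B"
proof -
  note D = stochastic_gradient_atD[OF sg]
  have int: "integrable M (\<lambda>w. (norm (G i x (\<xi> k s w)))\<^sup>2)" for i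
    by (rule integrable_sample[OF D(3)])
  then show "integrable M (\<lambda>w. noise_bound Cf (\<lambda>i. G i x (\<xi> k s w)))"
    unfolding noise_bound_def by auto
  have "(\<Sum>i\<in>UNIV. \<integral>w. (norm (G i x (\<xi> k s w)))\<^sup>2 \<partial>M) \<le> (\<Sum>i\<in>(UNIV :: 'm set). Cf\<^sup>2)"
    using integral_sample[OF D(3)] D(4) by (intro sum_mono) simp
  then have "Cf\<^sup>2 * (1 + 2 * ln (real CARD('m))) * (\<Sum>i\<in>UNIV. \<integral>w. (norm (G i x (\<xi> k s w)))\<^sup>2 \<partial>M)
      \<le> Cf\<^sup>2 * (1 + 2 * ln (real CARD('m))) * (real CARD('m) * Cf\<^sup>2)"
    using m by (intro mult_left_mono) auto
  then show "(\<integral>w. noise_bound Cf (\<lambda>i. G i x (\<xi> k s w)) \<partial>M) \<le> B"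
    using int by (simp add: noise_bound_def B_def prob_space)
qed

text \<open>The sampling noise has mean zero given the iterate because \<open>grad_phi\<close> is affine in the
  sampled gradients.  Against a saddle point, the bilinear parts of the operator cancel and only
  the squared distance of the directions remains.\<close>

lemma integral_grad_phi_ge:
  fixes f :: "'m \<Rightarrow> real ^ 'n \<Rightarrow> real" and k s :: nat and \<gamma>
  assumes sg: "stochastic_gradient_at f G N Cf \<delta> x"
    and l: "l \<in> prob_simplex" "(\<Sum>i\<in>UNIV. l $ i *\<^sub>R grad (f i) x) = - d"
      "\<And>i. grad (f i) x \<bullet> d \<le> - (norm d)\<^sup>2"
  defines "z \<equiv> \<lambda>w. inner_iter G Cf \<gamma> x (\<lambda>s. \<xi> k s w) s"
  shows "integrable M (\<lambda>w. grad_phi (\<lambda>i. G i x (\<xi> k s w)) (z w) \<bullet> (z w - (d, l)))"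
    and "(\<integral>w. (norm (fst (z w) - d))\<^sup>2 \<partial>M)
      \<le> (\<integral>w. grad_phi (\<lambda>i. G i x (\<xi> k s w)) (z w) \<bullet> (z w - (d, l)) \<partial>M)"
proof -
  note [measurable] = borel_measurable_fst_comp borel_measurable_snd_comp borel_measurable_vec_nth
  note D = stochastic_gradient_atD[OF sg]
  have zm[measurable]: "z \<in> borel_measurable M" unfolding z_def by measurable
  have zn: "norm (fst (z w)) \<le> Cf" for w unfolding z_def by (rule inner_iter_norm[OF m Cf])
  have zs: "snd (z w) \<in> prob_simplex" for w unfolding z_def by (rule inner_iter_simplex[OF m Cf])
  \<comment> \<open>\<open>Y i\<close> is the coefficient of the i-th sampled gradient in
    \<open>grad_phi_inner_diff\<close>; it is bounded and independent of the current sample.\<close>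
  define Y where "Y i p = l $ i *\<^sub>R fst p - snd p $ i *\<^sub>R d" for i and p :: "(real ^ 'n) \<times> (real ^ 'm)"
  have Ym[measurable]: "Y i \<in> borel_measurable borel" for i
    unfolding Y_def by measurable
  have Yn: "norm (Y i (z w)) \<le> Cf + norm d" for i w
  proof -
    have "norm (Y i (z w)) \<le> \<bar>l $ i\<bar> * norm (fst (z w)) + \<bar>snd (z w) $ i\<bar> * norm d"
      unfolding Y_def by (rule order.trans[OF norm_triangle_ineq4]) simp
    also have "\<dots> \<le> 1 * Cf + 1 * norm d"
      using zn prob_simplex_nonneg[OF l(1)] prob_simplex_le_1[OF l(1)]
        prob_simplex_nonneg[OF zs] prob_simplex_le_1[OF zs]
      by (intro add_mono mult_mono) auto
    finally show ?thesis by simp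
  qed
  have Yi: "integrable M (\<lambda>w. Y i (z w))" for i
    by (rule integrable_bounded[OF _ Yn]) measurable
  have Gi: "integrable M (\<lambda>w. G i x (\<xi> k s w))"
    and Ge: "(\<integral>w. G i x (\<xi> k s w) \<partial>M) = grad (f i) x" for i
    using integrable_sample[OF D(1)] integral_sample[OF D(1)] D(2) by auto
  have ind: "indep_var borel (\<lambda>w. G i x (\<xi> k s w)) borel (\<lambda>w. Y i (z w))" for i
    unfolding z_def by (intro indep_var_sample_inner_iter G_fixed_point_measurable Ym)
  note GY = integrable_inner_indep_var[OF ind Gi Yi] integral_inner_indep_var[OF ind Gi Yi]
  have di: "integrable M (\<lambda>w. fst (z w) \<bullet> (fst (z w) - d))"
  proof (rule integrable_bounded)
    fix w
    have "norm (fst (z w) \<bullet> (fst (z w) - d)) \<le> norm (fst (z w)) * norm (fst (z w) - d)"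
      by (simp add: Cauchy_Schwarz_ineq2)
    also have "\<dots> \<le> Cf * (Cf + norm d)"
      using zn[of w] Cf by (intro mult_mono order.trans[OF norm_triangle_ineq4]) auto
    finally show "norm (fst (z w) \<bullet> (fst (z w) - d)) \<le> Cf * (Cf + norm d)" .
  qed measurable
  have F: "grad_phi g (z w) \<bullet> (z w - (d, l)) = (\<Sum>i\<in>UNIV. g i \<bullet> Y i (z w)) + fst (z w) \<bullet> (fst (z w) - d)"
    for g :: "'m \<Rightarrow> real ^ 'n" and w
    by (simp add: grad_phi_inner_diff Y_def)
  show "integrable M (\<lambda>w. grad_phi (\<lambda>i. G i x (\<xi> k s w)) (z w) \<bullet> (z w - (d, l)))"
    unfolding F by (intro Bochner_Integration.integrable_add Bochner_Integration.integrable_sum GY di)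
  have "(\<integral>w. (norm (fst (z w) - d))\<^sup>2 \<partial>M)
      \<le> (\<integral>w. (\<Sum>i\<in>UNIV. grad (f i) x \<bullet> Y i (z w)) + fst (z w) \<bullet> (fst (z w) - d) \<partial>M)"
  proof (rule integral_mono)
    show "integrable M (\<lambda>w. (norm (fst (z w) - d))\<^sup>2)"
    proof (rule integrable_bounded)
      fix w show "norm ((norm (fst (z w) - d))\<^sup>2) \<le> (Cf + norm d)\<^sup>2"
        using zn[of w] by (auto intro!: power_mono order.trans[OF norm_triangle_ineq4])
    qed measurable
    show "integrable M (\<lambda>w. (\<Sum>i\<in>UNIV. grad (f i) x \<bullet> Y i (z w)) + fst (z w) \<bullet> (fst (z w) - d))"
      using Yi di by auto
    fix w
    have "(\<Sum>i\<in>UNIV. snd (z w) $ i * (grad (f i) x \<bullet> d)) \<le> - (norm d)\<^sup>2"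
      by (rule convex_combination_le[OF zs l(3)])
    \<comment> \<open>With the mean gradients, the weights \<open>l\<close> contribute minus the
      inner product of d with the current direction, and the weights of z contribute at least |d|^2.
      Together with the last term this completes the square.\<close>
    moreover have "(\<Sum>i\<in>UNIV. grad (f i) x \<bullet> Y i (z w)) =
        (\<Sum>i\<in>UNIV. l $ i *\<^sub>R grad (f i) x) \<bullet> fst (z w)
        - (\<Sum>i\<in>UNIV. snd (z w) $ i * (grad (f i) x \<bullet> d))"
      by (simp add: Y_def inner_diff_right sum_subtractf inner_sum_left)
    ultimately show "(norm (fst (z w) - d))\<^sup>2
        \<le> (\<Sum>i\<in>UNIV. grad (f i) x \<bullet> Y i (z w)) + fst (z w) \<bullet> (fst (z w) - d)"
      unfolding l(2) by (simp add: power2_norm_eq_inner inner_diff inner_commute)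
  qed
  also have "\<dots> = (\<integral>w. grad_phi (\<lambda>i. G i x (\<xi> k s w)) (z w) \<bullet> (z w - (d, l)) \<partial>M)"
    unfolding F
    using Yi di GY by (simp add: Ge)
  finally show "(\<integral>w. (norm (fst (z w) - d))\<^sup>2 \<partial>M)
      \<le> (\<integral>w. grad_phi (\<lambda>i. G i x (\<xi> k s w)) (z w) \<bullet> (z w - (d, l)) \<partial>M)" .
qed

text \<open>For fixed x the saddle point is deterministic and feasible, so the pathwise regret
  against it can be integrated, and each of its terms is bounded below by
  \<open>integral_grad_phi_ge\<close>.\<close>

lemma expected_inner_regret:
  assumes sg: "stochastic_gradient_at f G N Cf \<delta> x" and \<gamma>: "\<And>s. 0 < \<gamma> s"
  defines "B \<equiv> Cf\<^sup>2 * (1 + 2 * ln (real CARD('m))) * (real CARD('m) * Cf\<^sup>2) + Cf ^ 4"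
  shows "(\<Sum>s<T. \<gamma> s * (\<integral>w. (norm (fst (inner_iter G Cf \<gamma> x (\<lambda>s. \<xi> k s w) s) - descent_dir f x))\<^sup>2 \<partial>M))
    \<le> 1 + B * (\<Sum>s<T. (\<gamma> s)\<^sup>2)"
proof -
  define d where "d = descent_dir f x"
  obtain l :: "real ^ 'm" where l: "l \<in> prob_simplex" "(\<Sum>i\<in>UNIV. l $ i *\<^sub>R grad (f i) x) = - d"
      "\<And>i. grad (f i) x \<bullet> d \<le> - (norm d)\<^sup>2"
    unfolding d_def using descent_dir_saddle[of f x] by metis
  have "norm d \<le> Cf"
    using norm_descent_dir_le norm_grad_le[OF N Cf sg] unfolding d_def by (rule order.trans)
  then have u: "(d, l) \<in> feasible Cf" using l(1) by (simp add: feasible_def)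
  define z where "z s w = inner_iter G Cf \<gamma> x (\<lambda>s. \<xi> k s w) s" for s w
  define F where "F s w = grad_phi (\<lambda>i. G i x (\<xi> k s w)) (z s w) \<bullet> (z s w - (d, l))" for s w
  have Fi: "integrable M (F s)"
    and Fge: "(\<integral>w. (norm (fst (z s w) - d))\<^sup>2 \<partial>M) \<le> (\<integral>w. F s w \<partial>M)" for s
    using integral_grad_phi_ge[OF sg l] unfolding F_def z_def by auto
  note nb = integral_noise_bound[OF sg, folded B_def]
  have "(\<Sum>s<T. \<gamma> s * (\<integral>w. (norm (fst (z s w) - d))\<^sup>2 \<partial>M)) \<le> (\<Sum>s<T. \<gamma> s * (\<integral>w. F s w \<partial>M))"
    using \<gamma> Fge by (intro sum_mono mult_left_mono) (auto simp: less_imp_le)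
  also have "\<dots> = (\<integral>w. (\<Sum>s<T. \<gamma> s * F s w) \<partial>M)"
    using Fi by simp
  also have "\<dots> \<le> (\<integral>w. 1 + (\<Sum>s<T. (\<gamma> s)\<^sup>2 * noise_bound Cf (\<lambda>i. G i x (\<xi> k s w))) \<partial>M)"
    using Fi nb(1) inner_iter_regret[OF m Cf u, of \<gamma> G x _ T]
    unfolding F_def z_def by (intro integral_mono) auto
  also have "\<dots> = 1 + (\<Sum>s<T. (\<gamma> s)\<^sup>2 * (\<integral>w. noise_bound Cf (\<lambda>i. G i x (\<xi> k s w)) \<partial>M))"
    using nb(1) by (simp add: prob_space)
  also have "\<dots> \<le> 1 + (\<Sum>s<T. (\<gamma> s)\<^sup>2 * B)"
    using nb(2) by (intro add_left_mono sum_mono mult_left_mono) auto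
  finally show ?thesis by (simp add: z_def d_def sum_distrib_left mult.commute)
qed

end

subsection \<open>Rates for step sizes of order $s^{-1/2}$\<close>

lemma avg_start_bounds:
  assumes "0 < r" "r < 1"
  shows "real (avg_start r S) \<le> r * real S + 1" and "avg_start r S \<le> S"
    and "1 \<le> S \<Longrightarrow> 1 \<le> avg_start r S"
proof -
  have "0 \<le> r * real S" using assms by simp
  then have "real (avg_start r S) = of_int \<lceil>r * real S\<rceil>" by (simp add: avg_start_def)
  then show "real (avg_start r S) \<le> r * real S + 1" by linarith
  have "r * real S \<le> 1 * real S" using assms by (intro mult_right_mono) auto
  then show "avg_start r S \<le> S" unfolding avg_start_def by linarith
  assume "1 \<le> S"
  then have "0 < r * real S" using assms by simp
  then show "1 \<le> avg_start r S" unfolding avg_start_def by linarith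
qed

text \<open>The logarithm is traded for the cruder square root of n, through ln(n^2) = 4 ln(sqrt n).
  With n^2 steps the window has weight of order n, so the averaged error still decays like a power
  of n.\<close>

lemma sum_inverse_le:
  "(\<Sum>s=1..n\<^sup>2. 1 / real s) \<le> 1 + 4 * sqrt (real n)" if "1 \<le> n"
proof -
  have n: "1 \<le> real n" using that by simp
  have "(\<Sum>s=1..n\<^sup>2. 1 / real s) = harm (n\<^sup>2)" by (simp add: harm_def divide_inverse)
  \<comment> \<open>The sequence of harmonic number minus logarithm decreases from its first value
    1.\<close>
  also have "\<dots> \<le> ln (real (n\<^sup>2)) + 1" 
    using euler_mascheroni_sequence_decreasing[of 1 "n\<^sup>2"] that by (simp add: harm_def)
  also have "ln (real (n\<^sup>2)) = 4 * ln (sqrt (real n))"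
    using n by (simp add: ln_sqrt ln_realpow)
  also have "ln (sqrt (real n)) \<le> sqrt (real n)"
    using ln_le_minus_one[of "sqrt (real n)"] n by simp
  finally show ?thesis by simp
qed

text \<open>Here q is the square root of the number of steps. The numerator is of order sqrt q and
  the window weight of order q, so \<open>e\<close> = q^(-1/4) balances the two terms.\<close>

lemma direction_error_rate:
  fixes \<gamma> :: "nat \<Rightarrow> real"
  assumes r: "0 < r" "r < 1" and a: "0 < a" and B: "0 \<le> B"
    and \<gamma>: "\<And>s. 1 \<le> s \<Longrightarrow> \<gamma> s = a / sqrt (real s)" and q: "1 \<le> q"
  defines "e \<equiv> real q powr (-1/4)"
  shows "e / 2 + (1 + B * (\<Sum>s\<le>q\<^sup>2. (\<gamma> s)\<^sup>2)) / (2 * e * (\<Sum>s = avg_start r (q\<^sup>2)..q\<^sup>2. \<gamma> s))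
    \<le> (1 / 2 + (1 + B * ((\<gamma> 0)\<^sup>2 + 5 * a\<^sup>2)) / (2 * (1 - r) * a)) * real q powr (-1/4)"
proof -
  define P where "P = avg_start r (q\<^sup>2)"
  have rq: "1 \<le> real q" using q by simp
  have q2: "1 \<le> q\<^sup>2" using q by simp
  have sq: "1 \<le> sqrt (real q)" using rq by simp
  have P: "1 \<le> P" "P \<le> q\<^sup>2" "real P \<le> r * real (q\<^sup>2) + 1"
    unfolding P_def using avg_start_bounds[OF r, of "q\<^sup>2"] q2 by auto
  \<comment> \<open>The step size at 0 is arbitrary, so its square is kept apart.\<close>
  have "(\<Sum>s\<le>q\<^sup>2. (\<gamma> s)\<^sup>2) = (\<gamma> 0)\<^sup>2 + (\<Sum>s=1..q\<^sup>2. (\<gamma> s)\<^sup>2)"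
    by (simp add: atMost_atLeast0 sum.atLeast_Suc_atMost)
  also have "(\<Sum>s=1..q\<^sup>2. (\<gamma> s)\<^sup>2) = a\<^sup>2 * (\<Sum>s=1..q\<^sup>2. 1 / real s)"
    unfolding sum_distrib_left
    by (intro sum.cong) (auto simp: \<gamma> power_divide)
  also have "\<dots> \<le> a\<^sup>2 * (1 + 4 * sqrt (real q))"
    using sum_inverse_le[OF q] by (intro mult_left_mono) auto
  also have "(\<gamma> 0)\<^sup>2 + a\<^sup>2 * (1 + 4 * sqrt (real q)) \<le> ((\<gamma> 0)\<^sup>2 + 5 * a\<^sup>2) * sqrt (real q)"
  proof -
    have "0 \<le> ((\<gamma> 0)\<^sup>2 + a\<^sup>2) * (sqrt (real q) - 1)" using sq by simp
    then show ?thesis by (simp add: algebra_simps)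
  qed
  finally have "1 + B * (\<Sum>s\<le>q\<^sup>2. (\<gamma> s)\<^sup>2)
      \<le> 1 * sqrt (real q) + B * (((\<gamma> 0)\<^sup>2 + 5 * a\<^sup>2) * sqrt (real q))"
    using B sq by (intro add_mono mult_left_mono) auto
  then have num: "1 + B * (\<Sum>s\<le>q\<^sup>2. (\<gamma> s)\<^sup>2) \<le> (1 + B * ((\<gamma> 0)\<^sup>2 + 5 * a\<^sup>2)) * sqrt (real q)"
    by (simp add: algebra_simps)
  have "(1 - r) * a * real q = ((1 - r) * real (q\<^sup>2)) * (a / real q)"
    using rq by (simp add: power2_eq_square field_simps)
  \<comment> \<open>The window includes both ends; this extra term absorbs the 1 lost in rounding up
    its start.\<close>
  also have "\<dots> \<le> real (Suc (q\<^sup>2) - P) * (a / real q)"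
    using P a by (intro mult_right_mono) (auto simp: of_nat_diff algebra_simps)
  also have "\<dots> = (\<Sum>s = P..q\<^sup>2. a / real q)" by simp
  \<comment> \<open>As the window starts at an index at least 1, the arbitrary step size at 0 stays
    out of it.\<close>
  also have "\<dots> \<le> (\<Sum>s = P..q\<^sup>2. \<gamma> s)"
  proof (rule sum_mono)
    fix s assume s: "s \<in> {P..q\<^sup>2}"
    then have "1 \<le> s" "real s \<le> (real q)\<^sup>2" using P(1) by (auto simp flip: of_nat_power)
    moreover from this have "sqrt (real s) \<le> real q" by (intro real_le_lsqrt) auto
    ultimately show "a / real q \<le> \<gamma> s"
      unfolding \<gamma>[OF \<open>1 \<le> s\<close>] using a rq
      by (intro divide_left_mono mult_pos_pos) auto
  qed
  finally have den: "(1 - r) * a * real q \<le> (\<Sum>s = P..q\<^sup>2. \<gamma> s)" .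
  have e: "0 < e" using rq by (simp add: e_def)
  have pow: "sqrt (real q) / (e * real q) = e"
  proof -
    have "real q powr (-1/4 + -1/4 + 1) = e * e * real q"
      using rq by (simp only: powr_add e_def) simp
    then have "sqrt (real q) = e * e * real q"
      using rq by (simp add: powr_half_sqrt)
    then show ?thesis using e rq by simp
  qed
  have "(1 + B * (\<Sum>s\<le>q\<^sup>2. (\<gamma> s)\<^sup>2)) / (2 * e * (\<Sum>s = P..q\<^sup>2. \<gamma> s))
      \<le> ((1 + B * ((\<gamma> 0)\<^sup>2 + 5 * a\<^sup>2)) * sqrt (real q)) / (2 * e * ((1 - r) * a * real q))"
    using num den e B a r rq by (intro frac_le mult_left_mono) auto
  also have "\<dots> = (1 + B * ((\<gamma> 0)\<^sup>2 + 5 * a\<^sup>2)) / (2 * (1 - r) * a) * (sqrt (real q) / (e * real q))"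
    by simp
  finally show ?thesis unfolding pow P_def e_def[symmetric] distrib_right by simp
qed

context gradient_sampling
begin

lemma expected_direction_error:
  fixes k :: nat
  assumes sg: "stochastic_gradient_at f G N Cf \<delta> x" and \<gamma>: "\<And>s. 0 < \<gamma> s"
    and PS: "avg_start r S \<le> S" and e: "0 < e"
  defines "B \<equiv> Cf\<^sup>2 * (1 + 2 * ln (real CARD('m))) * (real CARD('m) * Cf\<^sup>2) + Cf ^ 4"
  defines "D \<equiv> \<lambda>w. fst (averaged r \<gamma> S (inner_iter G Cf \<gamma> x (\<lambda>s. \<xi> k s w)))"
  shows "(\<integral>\<^sup>+w. ennreal (norm (D w - descent_dir f x)) \<partial>M)
    \<le> ennreal (e / 2 + (1 + B * (\<Sum>s\<le>S. (\<gamma> s)\<^sup>2)) / (2 * e * (\<Sum>s = avg_start r S..S. \<gamma> s)))"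
proof -
  note [measurable] = borel_measurable_fst_comp
  define v where "v = descent_dir f x"
  define W where "W = (\<Sum>s = avg_start r S..S. \<gamma> s)"
  have W: "0 < W" unfolding W_def using PS \<gamma> by (intro sum_pos) auto
  define d where "d w s = fst (inner_iter G Cf \<gamma> x (\<lambda>s. \<xi> k s w) s)" for w s
  have dm[measurable]: "(\<lambda>w. d w s) \<in> borel_measurable M" for s unfolding d_def by measurable
  have dn: "norm (d w s) \<le> Cf" for w s unfolding d_def by (rule inner_iter_norm[OF m Cf])
  have int: "integrable M (\<lambda>w. (norm (d w s - v))\<^sup>2)" for s
  proof (rule integrable_bounded)
    fix w show "norm ((norm (d w s - v))\<^sup>2) \<le> (Cf + norm v)\<^sup>2"
      using dn[of w s] by (auto intro!: power_mono order.trans[OF norm_triangle_ineq4])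
  qed measurable
  have D: "D w = averaged r \<gamma> S (d w)" for w
    by (simp add: D_def averaged_fst flip: d_def)
  have Dm[measurable]: "D \<in> borel_measurable M"
    unfolding D averaged_def by measurable
  have Dn: "norm (D w) \<le> Cf" for w
    unfolding D by (intro norm_averaged_le \<gamma> PS dn)
  have Di: "integrable M (\<lambda>w. norm (D w - v))"
  proof (rule integrable_bounded)
    fix w show "norm (norm (D w - v)) \<le> Cf + norm v"
      using Dn[of w] by (auto intro!: order.trans[OF norm_triangle_ineq4])
  qed measurable
  have "(\<integral>w. norm (D w - v) \<partial>M)
      \<le> (\<integral>w. e / 2 + (\<Sum>s\<le>S. \<gamma> s * (norm (d w s - v))\<^sup>2) / (2 * e * W) \<partial>M)"
    unfolding W_def D
    using int Di[unfolded D] norm_averaged_diff_le[OF \<gamma> PS e] by (intro integral_mono) auto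
  also have "\<dots> = e / 2 + (\<Sum>s\<le>S. \<gamma> s * (\<integral>w. (norm (d w s - v))\<^sup>2 \<partial>M)) / (2 * e * W)"
    using int by (simp add: prob_space)
  \<comment> \<open>The average includes the final iterate \<open>S\<close>, so the regret runs over
    S + 1 steps. The last one is fictitious: its sample enters the estimate but not the
    average.\<close>
  also have "\<dots> \<le> e / 2 + (1 + B * (\<Sum>s\<le>S. (\<gamma> s)\<^sup>2)) / (2 * e * W)"
    using expected_inner_regret[OF sg \<gamma>, where T = "Suc S" and k = k] W e
    unfolding d_def v_def B_def lessThan_Suc_atMost
    by (intro add_left_mono divide_right_mono) auto
  finally have "(\<integral>w. norm (D w - v) \<partial>M) \<le> e / 2 + (1 + B * (\<Sum>s\<le>S. (\<gamma> s)\<^sup>2)) / (2 * e * W)" .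
  then show ?thesis
    unfolding v_def[symmetric] W_def[symmetric]
    by (subst nn_integral_eq_integral[OF Di]) (auto intro: ennreal_leI)
qed

end

section \<open>The outer loop\<close>

locale msmd_run = gradient_sampling M G N \<xi> Cf
  for M :: "'w measure"
    and G :: "'m::finite \<Rightarrow> real ^ 'n \<Rightarrow> 'e \<Rightarrow> real ^ 'n"
    and N :: "'e measure" and \<xi> :: "nat \<Rightarrow> nat \<Rightarrow> 'w \<Rightarrow> 'e" and Cf :: real +
  fixes f :: "'m \<Rightarrow> real ^ 'n \<Rightarrow> real"
    and x0 :: "real ^ 'n" and L \<delta> Finf a \<rho> r :: real and \<gamma> \<alpha> :: "nat \<Rightarrow> real"
  assumes diff: "\<And>i x. f i differentiable (at x)"
    and lip: "\<And>i. L-lipschitz_on UNIV (grad (f i))"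
    and a: "0 < a" and \<rho>: "0 < \<rho>" and r: "0 < r" "r < 1"
    and \<gamma>0: "0 < \<gamma> 0" and \<gamma>: "\<And>s. 1 \<le> s \<Longrightarrow> \<gamma> s = a / sqrt (real s)"
    and \<alpha>: "\<And>k. \<alpha> k = \<rho> / (real k + 1)"
begin

text \<open>The schedule \<open>S\<close> of inner steps remains a parameter, so that both regimes
  of the theorem share one analysis.\<close>

definition iter :: "(nat \<Rightarrow> nat) \<Rightarrow> nat \<Rightarrow> 'w \<Rightarrow> real ^ 'n" where
  "iter S k w = msmd G Cf r \<gamma> \<alpha> S x0 (\<lambda>k s. \<xi> k s w) k"

definition direction :: "(nat \<Rightarrow> nat) \<Rightarrow> nat \<Rightarrow> 'w \<Rightarrow> real ^ 'n" where
  "direction S k w = fst (averaged r \<gamma> (S k) (inner_iter G Cf \<gamma> (iter S k w) (\<lambda>s. \<xi> k s w)))"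

definition noise_const :: real where
  "noise_const = Cf\<^sup>2 * (1 + 2 * ln (real CARD('m))) * (real CARD('m) * Cf\<^sup>2) + Cf ^ 4"

text \<open>The constant of \<open>direction_error_rate\<close>, uniform over all outer iterations
  and schedules.\<close>

definition rate_const :: real where
  "rate_const = 1 / 2 + (1 + noise_const * ((\<gamma> 0)\<^sup>2 + 5 * a\<^sup>2)) / (2 * (1 - r) * a)"

lemma \<gamma>_pos: "0 < \<gamma> s"
  using \<gamma>0 \<gamma>[of s] a by (cases "s = 0") auto

lemma \<alpha>_pos: "0 < \<alpha> k"
  using \<rho> by (simp add: \<alpha>)

lemma L_nonneg: "0 \<le> L"
  using lip lipschitz_on_nonneg by blast

lemma noise_const_nonneg: "0 \<le> noise_const"
  using m by (simp add: noise_const_def)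

lemma rate_const_pos: "0 < rate_const"
  using noise_const_nonneg a r unfolding rate_const_def by (intro add_pos_nonneg) auto

lemma iter_Suc: "iter S (Suc k) w = iter S k w + \<alpha> k *\<^sub>R direction S k w"
  by (simp add: iter_def direction_def)

lemma iter_measurable[measurable]: "iter S k \<in> borel_measurable M"
  unfolding iter_def by (intro borel_measurable_msmd[OF m Cf G_meas]) auto

lemma direction_measurable[measurable]: "direction S k \<in> borel_measurable M"
  unfolding direction_def by (intro borel_measurable_averaged_direction[OF m Cf G_meas]) auto

lemma norm_direction_le: "norm (direction S k w) \<le> Cf"
  unfolding direction_def averaged_fst
  by (intro norm_averaged_le \<gamma>_pos avg_start_bounds(2)[OF r] inner_iter_norm[OF m Cf])

text \<open>Each iterate stays in a deterministic ball, where the continuous objectives are bounded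
  and hence integrable.\<close>

lemma norm_iter_le: "norm (iter S k w) \<le> norm x0 + (\<Sum>j<k. \<alpha> j * Cf)"
proof (induction k)
  case 0
  show ?case by (simp add: iter_def)
next
  case (Suc k)
  have "norm (\<alpha> k *\<^sub>R direction S k w) \<le> \<alpha> k * Cf"
    using norm_direction_le \<alpha>_pos[of k] by (simp add: mult_left_mono)
  then show ?case
    unfolding iter_Suc using norm_triangle_mono[OF Suc] by (simp add: add.assoc)
qed

lemma integrable_objective: "integrable M (\<lambda>w. f i (iter S k w))"
proof -
  have cont: "continuous_on A (f i)" for A
    by (intro continuous_at_imp_continuous_on ballI differentiable_imp_continuous_within diff)
  define b where "b = norm x0 + (\<Sum>j<k. \<alpha> j * Cf)"
  have "compact (f i ` cball 0 b)" by (intro compact_continuous_image cont compact_cball)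
  then have "bounded (f i ` cball 0 b)" by (rule compact_imp_bounded)
  then obtain C where "\<forall>y\<in>f i ` cball 0 b. norm y \<le> C" unfolding bounded_iff by (elim exE)
  then have C: "norm (f i x) \<le> C" if "x \<in> cball 0 b" for x using that by (rule bspec[OF _ imageI])
  show ?thesis
  proof (rule integrable_bounded)
    show "(\<lambda>w. f i (iter S k w)) \<in> borel_measurable M"
      by (rule borel_measurable_continuous_on[OF cont iter_measurable])
    show "norm (f i (iter S k w)) \<le> C" for w
      using norm_iter_le[of S k w] by (intro C) (simp add: b_def)
  qed
qed

lemma descent_dir_iter_measurable[measurable]:
  "(\<lambda>w. descent_dir f (iter S k w)) \<in> borel_measurable M"
  by (rule measurable_compose[OF iter_measurable borel_measurable_descent_dir[OF lip]])

text \<open>The samples of outer iteration \<open>k\<close> are independent of the iterate, so that the estimate for a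
  fixed point integrates.\<close>

lemma integral_direction_error:
  assumes ok: "AE w in M. stochastic_gradient_at f G N Cf \<delta> (iter S k w)"
    and S: "S k = q\<^sup>2" and q: "1 \<le> q"
  shows "(\<integral>w. norm (direction S k w - descent_dir f (iter S k w)) \<partial>M) \<le> rate_const * real q powr (-1/4)"
proof (rule integral_real_bounded)
  show "0 \<le> rate_const * real q powr (-1/4)" using rate_const_pos by simp
  \<comment> \<open>\<open>I\<close> indexes the samples that determine the iterate,
    \<open>J\<close> those drawn in outer iteration k.\<close>
  define I J where "I = {..<k} \<times> (UNIV :: nat set)" and "J = {k} \<times> (UNIV :: nat set)"
  define X where "X \<eta> = msmd G Cf r \<gamma> \<alpha> S x0 (\<lambda>j t. \<eta> (j, t)) k" for \<eta>
  define h where "h p = ennreal (norm (fst (averaged r \<gamma> (S k)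
      (inner_iter G Cf \<gamma> (X (fst p)) (\<lambda>t. snd p (k, t)))) - descent_dir f (X (fst p))))"
    for p :: "(nat \<times> nat \<Rightarrow> 'e) \<times> (nat \<times> nat \<Rightarrow> 'e)"
  have Xm[measurable]: "X \<in> PiM I (\<lambda>_. N) \<rightarrow>\<^sub>M borel"
    unfolding X_def
    by (intro borel_measurable_msmd[OF m Cf G_meas] measurable_component_singleton) (simp add: I_def)
  have "(\<lambda>p. fst (averaged r \<gamma> (S k) (inner_iter G Cf \<gamma> (X (fst p)) (\<lambda>t. snd p (k, t)))))
      \<in> PiM I (\<lambda>_. N) \<Otimes>\<^sub>M PiM J (\<lambda>_. N) \<rightarrow>\<^sub>M borel"
  proof (rule borel_measurable_averaged_direction[OF m Cf G_meas])
    show "(\<lambda>p. snd p (k, t)) \<in> PiM I (\<lambda>_. N) \<Otimes>\<^sub>M PiM J (\<lambda>_. N) \<rightarrow>\<^sub>M N" for t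
      by (rule measurable_compose[OF measurable_snd measurable_component_singleton]) (simp add: J_def)
  qed measurable
  moreover have "(\<lambda>p. descent_dir f (X (fst p))) \<in> PiM I (\<lambda>_. N) \<Otimes>\<^sub>M PiM J (\<lambda>_. N) \<rightarrow>\<^sub>M borel"
    by (rule measurable_compose[OF _ borel_measurable_descent_dir[OF lip]]) measurable
  ultimately have hm: "h \<in> borel_measurable (PiM I (\<lambda>_. N) \<Otimes>\<^sub>M PiM J (\<lambda>_. N))"
    unfolding h_def by measurable
  have ind: "indep_var (PiM I (\<lambda>_. N)) (samples_on I) (PiM J (\<lambda>_. N)) (samples_on J)"
    using indep_var_restrict[OF indep, of I J] by (simp add: I_def J_def case_prod_beta disjoint_iff)
  have Xw: "X (samples_on I w) = iter S k w" for w
    unfolding X_def iter_def by (rule msmd_cong) (simp add: I_def)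
  have hw: "h (samples_on I w, samples_on J w') = ennreal (norm (fst (averaged r \<gamma> (S k)
      (inner_iter G Cf \<gamma> (iter S k w) (\<lambda>s. \<xi> k s w'))) - descent_dir f (iter S k w)))" for w w'
    by (simp add: h_def Xw J_def)
  have "(\<integral>\<^sup>+w. ennreal (norm (direction S k w - descent_dir f (iter S k w))) \<partial>M)
      = (\<integral>\<^sup>+w. h (samples_on I w, samples_on J w) \<partial>M)"
    by (simp add: hw direction_def)
  \<comment> \<open>From here w fixes the iterate while w' supplies fresh samples.\<close>
  also have "\<dots> = (\<integral>\<^sup>+w. \<integral>\<^sup>+w'. h (samples_on I w, samples_on J w') \<partial>M \<partial>M)"
    by (rule nn_integral_indep_var[OF ind hm])
  also have "\<dots> \<le> (\<integral>\<^sup>+w. ennreal (rate_const * real q powr (-1/4)) \<partial>M)"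
  proof (rule nn_integral_mono_AE)
    show "AE w in M. (\<integral>\<^sup>+w'. h (samples_on I w, samples_on J w') \<partial>M)
        \<le> ennreal (rate_const * real q powr (-1/4))"
      using ok
    proof eventually_elim
      case (elim w)
      define e where "e = real q powr (-1/4)"
      have e: "0 < e" using q by (simp add: e_def)
      have "(\<integral>\<^sup>+w'. h (samples_on I w, samples_on J w') \<partial>M)
          \<le> ennreal (e / 2 + (1 + noise_const * (\<Sum>s\<le>q\<^sup>2. (\<gamma> s)\<^sup>2))
            / (2 * e * (\<Sum>s = avg_start r (q\<^sup>2)..q\<^sup>2. \<gamma> s)))"
        unfolding hw noise_const_def S[symmetric]
        by (rule expected_direction_error[OF elim \<gamma>_pos avg_start_bounds(2)[OF r] e])
      also have "\<dots> \<le> ennreal (rate_const * real q powr (-1/4))"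
        unfolding e_def rate_const_def
        by (intro ennreal_leI direction_error_rate[OF r a noise_const_nonneg \<gamma> q])
      finally show ?case .
    qed
  qed
  also have "\<dots> = ennreal (rate_const * real q powr (-1/4))" by (simp add: emeasure_space_1)
  finally show "(\<integral>\<^sup>+w. ennreal (norm (direction S k w - descent_dir f (iter S k w))) \<partial>M)
      \<le> ennreal (rate_const * real q powr (-1/4))" .
qed

text \<open>The exact direction decreases every objective at rate |d|^2 to first order, so any
  single one can serve as potential. The inexact direction costs \<open>Cf\<close> times its
  distance to the exact one, and curvature costs a multiple of the squared step.\<close>

lemma expected_descent:
  assumes ok: "AE w in M. stochastic_gradient_at f G N Cf \<delta> (iter S k w)"
    and S: "S k = q\<^sup>2" and q: "1 \<le> q"
  shows "\<alpha> k * (\<integral>w. (norm (descent_dir f (iter S k w)))\<^sup>2 \<partial>M)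
    \<le> (\<integral>w. f i (iter S k w) \<partial>M) - (\<integral>w. f i (iter S (Suc k) w) \<partial>M)
      + \<alpha> k * Cf * (rate_const * real q powr (-1/4)) + L * (\<alpha> k)\<^sup>2 * Cf\<^sup>2"
proof -
  define v where "v w = descent_dir f (iter S k w)" for w
  have vm[measurable]: "v \<in> borel_measurable M" unfolding v_def by measurable
  have grad_le: "AE w in M. norm (grad (f i) (iter S k w)) \<le> Cf"
    using ok by eventually_elim (rule norm_grad_le[OF N Cf])
  then have vn: "AE w in M. norm (v w) \<le> Cf"
    by eventually_elim (unfold v_def, rule order.trans[OF norm_descent_dir_le])
  have vi: "integrable M (\<lambda>w. (norm (v w))\<^sup>2)"
  proof (rule integrable_const_bound)
    show "AE w in M. norm ((norm (v w))\<^sup>2) \<le> Cf\<^sup>2"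
      using vn by eventually_elim (simp add: power_mono)
  qed measurable
  have ei: "integrable M (\<lambda>w. norm (direction S k w - v w))"
  proof (rule integrable_const_bound)
    show "AE w in M. norm (norm (direction S k w - v w)) \<le> Cf + Cf"
      using vn
    proof eventually_elim
      case (elim w)
      then show ?case
        using norm_triangle_ineq4[of "direction S k w" "v w"] norm_direction_le[of S k w] by simp
    qed
  qed measurable
  have "(\<integral>w. f i (iter S (Suc k) w) \<partial>M) \<le> (\<integral>w. f i (iter S k w) - \<alpha> k * (norm (v w))\<^sup>2
      + \<alpha> k * Cf * norm (direction S k w - v w) + L * (\<alpha> k)\<^sup>2 * Cf\<^sup>2 \<partial>M)"
  proof (rule integral_mono_AE)
    show "AE w in M. f i (iter S (Suc k) w) \<le> f i (iter S k w) - \<alpha> k * (norm (v w))\<^sup>2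
      + \<alpha> k * Cf * norm (direction S k w - v w) + L * (\<alpha> k)\<^sup>2 * Cf\<^sup>2"
      using grad_le
    proof eventually_elim
      case (elim w)
      define x g D where "x = iter S k w" and "g = grad (f i) x" and "D = direction S k w"
      have "f i (x + \<alpha> k *\<^sub>R D) \<le> f i x + \<alpha> k * (g \<bullet> D) + L * (\<alpha> k)\<^sup>2 * (norm D)\<^sup>2"
        using lipschitz_grad_upper_bound[OF diff lip, of i "x + \<alpha> k *\<^sub>R D" x]
        by (simp add: g_def power_mult_distrib mult.assoc)
      moreover have "L * (\<alpha> k)\<^sup>2 * (norm D)\<^sup>2 \<le> L * (\<alpha> k)\<^sup>2 * Cf\<^sup>2"
        using L_nonneg norm_direction_le[of S k w]
        by (intro mult_left_mono power_mono) (auto simp: D_def)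
      moreover have "g \<bullet> D \<le> - (norm (v w))\<^sup>2 + Cf * norm (D - v w)"
      proof -
        have "g \<bullet> v w \<le> - (norm (v w))\<^sup>2"
          unfolding g_def v_def x_def[symmetric] using descent_dir_saddle[of f x] by metis
        moreover have "g \<bullet> (D - v w) \<le> norm g * norm (D - v w)" by (rule norm_cauchy_schwarz)
        moreover have "norm g * norm (D - v w) \<le> Cf * norm (D - v w)"
          using elim by (intro mult_right_mono) (auto simp: g_def x_def)
        ultimately show ?thesis by (simp add: inner_diff_right)
      qed
      then have "\<alpha> k * (g \<bullet> D) \<le> \<alpha> k * (- (norm (v w))\<^sup>2 + Cf * norm (D - v w))"
        using \<alpha>_pos[of k] by (intro mult_left_mono) auto
      ultimately show ?case
        unfolding iter_Suc x_def[symmetric] D_def[symmetric] by (simp add: algebra_simps)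
    qed
  qed (use integrable_objective vi ei in auto)
  also have "\<dots> = (\<integral>w. f i (iter S k w) \<partial>M) - \<alpha> k * (\<integral>w. (norm (v w))\<^sup>2 \<partial>M)
      + \<alpha> k * Cf * (\<integral>w. norm (direction S k w - v w) \<partial>M) + L * (\<alpha> k)\<^sup>2 * Cf\<^sup>2"
    using integrable_objective vi ei by (simp add: prob_space)
  also have "\<alpha> k * Cf * (\<integral>w. norm (direction S k w - v w) \<partial>M)
      \<le> \<alpha> k * Cf * (rate_const * real q powr (-1/4))"
    using integral_direction_error[OF ok S q] \<alpha>_pos[of k] Cf
    unfolding v_def by (intro mult_left_mono) auto
  finally show ?thesis by (simp add: v_def)
qed

text \<open>Exponent -5/4 is -1 from the outer step size and -1/4 from the direction error; the
  curvature term, of exponent -2, is dominated by the same series.\<close>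

definition total_const :: real where
  "total_const = (\<rho> * Cf * rate_const + L * \<rho>\<^sup>2 * Cf\<^sup>2) * (\<Sum>k. real (Suc k) powr (-5/4))"

text \<open>Telescoping of \<open>expected_descent\<close>. The condition on \<open>S\<close> covers
  a fixed schedule (K+1)^2 as well as the growing one (k+1)^2.\<close>

lemma sum_expected_descent:
  assumes ok: "\<And>k. k \<le> K \<Longrightarrow> iterate_ok f G N Cf \<delta> Finf M (iter S k)"
    and S: "\<And>k. k < K \<Longrightarrow> \<exists>q. S k = q\<^sup>2 \<and> k + 1 \<le> q"
  shows "(\<Sum>k<K. \<alpha> k * (\<integral>w. (norm (descent_dir f (iter S k w)))\<^sup>2 \<partial>M))
    \<le> f i x0 - Finf + total_const"
proof -
  define E where "E k = (\<integral>w. f i (iter S k w) \<partial>M)" for k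
  define c where "c = \<rho> * Cf * rate_const + L * \<rho>\<^sup>2 * Cf\<^sup>2"
  define p where "p k = real (Suc k) powr (-5/4)" for k
  have c: "0 \<le> c" using \<rho> Cf rate_const_pos L_nonneg by (simp add: c_def)
  have "(\<Sum>k<K. \<alpha> k * (\<integral>w. (norm (descent_dir f (iter S k w)))\<^sup>2 \<partial>M))
      \<le> (\<Sum>k<K. E k - E (Suc k) + c * p k)"
  proof (rule sum_mono)
    fix k assume "k \<in> {..<K}"
    then have k: "k < K" by simp
    from S[OF k] obtain q where Sk: "S k = q\<^sup>2" and qk: "k + 1 \<le> q" by blast
    have sg: "AE w in M. stochastic_gradient_at f G N Cf \<delta> (iter S k w)"
      using ok[of k] k by (simp add: iterate_ok_def)
    have "real q powr (-1/4) \<le> real (Suc k) powr (-1/4)"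
      using qk by (intro powr_mono2') auto
    then have "\<alpha> k * Cf * (rate_const * real q powr (-1/4))
        \<le> \<alpha> k * Cf * (rate_const * real (Suc k) powr (-1/4))"
      using \<alpha>_pos[of k] Cf rate_const_pos by (intro mult_left_mono) auto
    also have "\<dots> = \<rho> * Cf * rate_const * p k"
    proof -
      have "p k * real (Suc k) = real (Suc k) powr (-1/4)"
        unfolding p_def using powr_mult_base[of "real (Suc k)" "-5/4"] by (simp add: mult.commute)
      then show ?thesis
        unfolding \<alpha> by (subst (asm) eq_commute) (simp only:, simp add: field_simps)
    qed
    finally have 1: "\<alpha> k * Cf * (rate_const * real q powr (-1/4)) \<le> \<rho> * Cf * rate_const * p k" .
    have "(\<alpha> k)\<^sup>2 \<le> \<rho>\<^sup>2 * p k"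
    proof -
      have "real (Suc k) powr (-2) \<le> p k" unfolding p_def by (intro powr_mono) auto
      then have "\<rho>\<^sup>2 * real (Suc k) powr (-2) \<le> \<rho>\<^sup>2 * p k" by (intro mult_left_mono) auto
      moreover have "real (Suc k) powr (-2) = 1 / (real k + 1)\<^sup>2"
        by (simp add: powr_minus powr_numeral inverse_eq_divide add.commute)
      ultimately show ?thesis by (simp add: \<alpha> power_divide)
    qed
    then have "L * Cf\<^sup>2 * (\<alpha> k)\<^sup>2 \<le> L * Cf\<^sup>2 * (\<rho>\<^sup>2 * p k)"
      using L_nonneg by (intro mult_left_mono) auto
    with 1 expected_descent[OF sg Sk _, of i] qk
    show "\<alpha> k * (\<integral>w. (norm (descent_dir f (iter S k w)))\<^sup>2 \<partial>M) \<le> E k - E (Suc k) + c * p k"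
      unfolding E_def c_def by (simp add: algebra_simps)
  qed
  also have "\<dots> = E 0 - E K + c * (\<Sum>k<K. p k)"
    using sum_lessThan_telescope'[of E K] by (simp add: sum.distrib sum_distrib_left)
  also have "E 0 = f i x0" by (simp add: E_def iter_def prob_space)
  also have "c * (\<Sum>k<K. p k) \<le> c * (\<Sum>k. p k)"
  proof (intro mult_left_mono c sum_le_suminf)
    have "summable (\<lambda>k. real k powr (-5/4))" by (subst summable_real_powr_iff) simp
    then show "summable p" unfolding p_def by (subst summable_Suc_iff)
  qed (auto simp: p_def)
  \<comment> \<open>The assumption at k = K, one beyond the last summand, supplies the lower bound
    on the final objective value.\<close>
  also have "f i x0 - E K \<le> f i x0 - Finf" using ok[of K] by (simp add: iterate_ok_def E_def)
  finally show ?thesis by (simp add: total_const_def c_def p_def)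
qed

lemma sum_step_sizes_ge: "\<rho> * ln (real K + 1) \<le> (\<Sum>k<K. \<alpha> k)"
proof -
  have "(\<Sum>k<K. \<alpha> k) = \<rho> * (\<Sum>k<K. 1 / (real k + 1))" by (simp add: \<alpha> sum_distrib_left)
  also have "(\<Sum>k<K. 1 / (real k + 1)) = harm K"
    unfolding harm_def using sum.atLeast1_atMost_eq[of "\<lambda>k. inverse (real k)" K]
    by (simp add: inverse_eq_divide add.commute)
  finally show ?thesis
    using ln_le_harm[of K] \<rho> by (simp add: add.commute)
qed

lemma weighted_average_le:
  assumes ok: "\<And>k. k \<le> K \<Longrightarrow> iterate_ok f G N Cf \<delta> Finf M (iter S k)"
    and S: "\<And>k. k < K \<Longrightarrow> \<exists>q. S k = q\<^sup>2 \<and> k + 1 \<le> q" and K: "1 \<le> K"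
  shows "(1 / (\<Sum>k<K. \<alpha> k)) * (\<Sum>k<K. \<alpha> k * (\<integral>w. (norm (descent_dir f (iter S k w)))\<^sup>2 \<partial>M))
    \<le> (f i x0 - Finf + total_const) / \<rho> / ln (real K + 1)"
proof -
  define s where "s = (\<Sum>k<K. \<alpha> k * (\<integral>w. (norm (descent_dir f (iter S k w)))\<^sup>2 \<partial>M))"
  have s: "0 \<le> s" unfolding s_def using \<alpha>_pos by (intro sum_nonneg mult_nonneg_nonneg) (auto simp: less_imp_le)
  have pos: "0 < \<rho> * ln (real K + 1)" using \<rho> K by simp
  have le: "s \<le> f i x0 - Finf + total_const"
    unfolding s_def by (rule sum_expected_descent[OF ok S])
  have "s / (\<Sum>k<K. \<alpha> k) \<le> (f i x0 - Finf + total_const) / (\<rho> * ln (real K + 1))"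
    by (rule frac_le[OF order.trans[OF s le] le pos sum_step_sizes_ge])
  then show ?thesis by (simp add: s_def)
qed

end

section \<open>Positivity of the constants and the two regimes\<close>

lemma Mstar_pos:
  assumes "2 \<le> n" "0 < Cf"
  shows "0 < Mstar n Cf \<delta>"
proof -
  have "0 < ln (real n)" using assms by simp
  then have "0 < (2 + ln (real n)) * (real n)\<^sup>2 * Cf ^ 4"
    and "0 \<le> (1 / 2 + ln (real n)) * (real n)\<^sup>2 * Cf\<^sup>2 * \<delta>\<^sup>2"
    using assms by (auto intro!: mult_pos_pos mult_nonneg_nonneg add_pos_pos)
  then show ?thesis by (simp add: Mstar_def)
qed

text \<open>The second summand alone is positive, so this holds for every real \<open>D\<close>,
  including the value 0 that \<open>Dbar\<close> takes when the supremum is infinite.\<close>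

lemma M2_pos:
  assumes r: "0 < r" "r < 1" and S: "1 \<le> S" and \<theta>: "0 < \<theta>" and Ms: "0 < Ms"
  shows "0 < M2 D Ms \<theta> r S"
proof -
  have P: "1 \<le> avg_start r S" "avg_start r S \<le> S" using avg_start_bounds[OF r, of S] S by auto
  have "0 \<le> 2 * D\<^sup>2 * real S / (real S - real (avg_start r S) + 1)"
    using P by (intro divide_nonneg_pos) auto
  moreover have "0 < sqrt (real S / real (avg_start r S))" using P S by simp
  moreover have "0 < max \<theta> (1 / \<theta>)" using \<theta> by simp
  ultimately show ?thesis unfolding M2_def using Ms by (intro mult_pos_pos add_nonneg_pos) auto
qed

theorem corollary4p4:
  fixes f :: "'m::finite \<Rightarrow> real ^ 'n \<Rightarrow> real"
    and G :: "'m \<Rightarrow> real ^ 'n \<Rightarrow> 'e \<Rightarrow> real ^ 'n"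
    and N :: "'e measure"
    and M :: "'w measure"
    and \<xi> :: "nat \<Rightarrow> nat \<Rightarrow> 'w \<Rightarrow> 'e"
    and x0 :: "real ^ 'n"
    and L Cf \<delta> Finf \<theta> \<rho> r Mf :: real
    and \<gamma> \<alpha> :: "nat \<Rightarrow> real"
    and Xa :: "nat \<Rightarrow> nat \<Rightarrow> 'w \<Rightarrow> real ^ 'n"
    and Xb :: "nat \<Rightarrow> 'w \<Rightarrow> real ^ 'n"
  assumes m: "2 \<le> CARD('m)"
    and diff: "\<And>i x. f i differentiable (at x)"
    and lip: "\<And>i. L-lipschitz_on UNIV (grad (f i))"
    and Cf: "0 < Cf" and \<delta>: "0 \<le> \<delta>"
    and \<theta>: "0 < \<theta>" and \<rho>: "0 < \<rho>" and r: "0 < r" "r < 1"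
    and N: "prob_space N" and M: "prob_space M"
    and G_meas: "\<And>i. (\<lambda>(x, e). G i x e) \<in> borel \<Otimes>\<^sub>M N \<rightarrow>\<^sub>M borel"
    and indep: "prob_space.indep_vars M (\<lambda>_. N) (\<lambda>(k, s). \<xi> k s) UNIV"
    and law: "\<And>k s. distr M N (\<xi> k s) = N"
    and Mf: "Mf = Max (range (\<lambda>i. f i x0)) - Finf"
    and \<gamma>0: "0 < \<gamma> 0"
    and \<gamma>: "\<And>s. 1 \<le> s \<Longrightarrow> \<gamma> s = \<theta> / (Mstar CARD('m) Cf \<delta> * sqrt (real s))"
    and \<alpha>: "\<And>k. \<alpha> k = \<rho> / (real k + 1)"
    and Xa: "\<And>K k w. Xa K k w = msmd G Cf r \<gamma> \<alpha> (\<lambda>_. (K + 1)\<^sup>2) x0 (\<lambda>k s. \<xi> k s w) k"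
    and Xb: "\<And>k w. Xb k w = msmd G Cf r \<gamma> \<alpha> (\<lambda>k. (k + 1)\<^sup>2) x0 (\<lambda>k s. \<xi> k s w) k"
  shows
    "((\<forall>K\<ge>1. \<forall>k\<le>K. iterate_ok f G N Cf \<delta> Finf M (Xa K k)) \<longrightarrow>
        (\<exists>c>0. \<forall>K\<ge>1.
           (1 / (\<Sum>k<K. \<alpha> k)) * (\<Sum>k<K. \<alpha> k * (\<integral>w. (norm (descent_dir f (Xa K k w)))\<^sup>2 \<partial>M))
           \<le> c * (max (L * real CARD('m) * Cf\<^sup>2 * \<rho> * pi\<^sup>2 / 3) (2 * Mf / \<rho>)
                  / ln (real K + 1))))
     \<and>
     ((\<forall>k. iterate_ok f G N Cf \<delta> Finf M (Xb k)) \<longrightarrow>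
        (\<exists>c>0. \<forall>K\<ge>1.
           (let M2K = Max ((\<lambda>k. M2 (Dbar Cf TYPE((real ^ 'n) \<times> (real ^ 'm)))
                                   (Mstar CARD('m) Cf \<delta>) \<theta> r ((k + 1)\<^sup>2)) ` {..<K})
            in (1 / (\<Sum>k<K. \<alpha> k)) * (\<Sum>k<K. \<alpha> k * (\<integral>w. (norm (descent_dir f (Xb k w)))\<^sup>2 \<partial>M))
               \<le> c * (Max {L * real CARD('m) * Cf\<^sup>2 * \<rho> * pi\<^sup>2 / 3,
                           2 * (\<Sum>k. 1 / real (Suc k) powr (3 / 2)) * Cf * sqrt M2K,
                           2 * (\<Sum>k. 1 / real (Suc k) ^ 3) * L * \<rho> * M2K,
                           2 * Mf / \<rho>}
                      * (1 / ln (real K + 1))))))"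
proof -
  have Ms: "0 < Mstar CARD('m) Cf \<delta>" by (rule Mstar_pos[OF m Cf])
  interpret prob_space M by (rule M)
  interpret msmd_run M G N \<xi> Cf f x0 L \<delta> Finf "\<theta> / Mstar CARD('m) Cf \<delta>" \<rho> r \<gamma> \<alpha>
  proof (intro msmd_run.intro gradient_sampling.intro gradient_sampling_axioms.intro
      msmd_run_axioms.intro)
    show "0 < \<theta> / Mstar CARD('m) Cf \<delta>" using \<theta> Ms by simp
    show "\<gamma> s = \<theta> / Mstar CARD('m) Cf \<delta> / sqrt (real s)" if "1 \<le> s" for s
      by (simp add: \<gamma>[OF that])
  qed (rule M m Cf N G_meas indep law diff lip \<rho> r \<gamma>0 \<alpha>)+
  \<comment> \<open>Any objective will do as potential.\<close>
  define i where "i = (undefined :: 'm)"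
  \<comment> \<open>The absolute value and the added 1 make \<open>b\<close> positive while keeping
    it an upper bound.\<close>
  define b where "b = \<bar>(f i x0 - Finf + total_const) / \<rho>\<bar> + 1"
  have b: "0 < b" unfolding b_def by linarith
  have le_b: "(1 / (\<Sum>k<K. \<alpha> k)) * (\<Sum>k<K. \<alpha> k * (\<integral>w. (norm (descent_dir f (iter S k w)))\<^sup>2 \<partial>M))
      \<le> b / ln (real K + 1)"
    if "\<And>k. k \<le> K \<Longrightarrow> iterate_ok f G N Cf \<delta> Finf M (iter S k)"
      and "\<And>k. k < K \<Longrightarrow> \<exists>q. S k = q\<^sup>2 \<and> k + 1 \<le> q" and "1 \<le> K" for S K
  proof (rule order.trans[OF weighted_average_le[OF that, of i]])
    have "(f i x0 - Finf + total_const) / \<rho> \<le> b" unfolding b_def by linarith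
    then show "(f i x0 - Finf + total_const) / \<rho> / ln (real K + 1) \<le> b / ln (real K + 1)"
      using \<open>1 \<le> K\<close> by (intro divide_right_mono) auto
  qed
  show ?thesis
  proof (intro conjI impI)
    assume ok: "\<forall>K\<ge>1. \<forall>k\<le>K. iterate_ok f G N Cf \<delta> Finf M (Xa K k)"
    define avg where "avg K = (1 / (\<Sum>k<K. \<alpha> k)) *
      (\<Sum>k<K. \<alpha> k * (\<integral>w. (norm (descent_dir f (Xa K k w)))\<^sup>2 \<partial>M))" for K
    have Xa': "Xa K k = iter (\<lambda>_. (K + 1)\<^sup>2) k" for K k
      by (rule ext) (simp add: Xa iter_def)
    have avg: "avg K \<le> b / ln (real K + 1)" if "1 \<le> K" for K
      unfolding avg_def Xa'
    proof (rule le_b[OF _ _ that])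
      show "iterate_ok f G N Cf \<delta> Finf M (iter (\<lambda>_. (K + 1)\<^sup>2) k)" if "k \<le> K" for k
        using ok \<open>1 \<le> K\<close> that unfolding Xa' by blast
      show "\<exists>q. (K + 1)\<^sup>2 = q\<^sup>2 \<and> k + 1 \<le> q" if "k < K" for k
        using that by (intro exI[of _ "K + 1"]) simp
    qed
    define Q where "Q = max (L * real CARD('m) * Cf\<^sup>2 * \<rho> * pi\<^sup>2 / 3) (2 * Mf / \<rho>)"
    show "\<exists>c>0. \<forall>K\<ge>1. avg K \<le> c * (Q / ln (real K + 1))"
    \<comment> \<open>\<open>Q\<close> does not depend on K, so if it is positive the constant b/Q
      works. Otherwise the right-hand side is 0 and the average itself must vanish.\<close>
    proof (cases "0 < Q")
      case True
      with avg b show ?thesis by (intro exI[of _ "b / Q"]) auto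
    next
      case False
      have "0 \<le> L * real CARD('m) * Cf\<^sup>2 * \<rho> * pi\<^sup>2 / 3" using L_nonneg \<rho> by simp
      with False have Q: "Q = 0" and "L * real CARD('m) * Cf\<^sup>2 * \<rho> * pi\<^sup>2 / 3 = 0"
        unfolding Q_def by linarith+
      then have "L = 0" using Cf \<rho> by simp
      \<comment> \<open>The gradients are constant, and so is the direction: its norm is bounded by every
        \<^term>\<open>avg K\<close>, hence zero.\<close>
      then have const: "descent_dir f x = descent_dir f x0" for x
        using dist_descent_dir_le[OF lip, where y = x and x = x0] by simp
      define n where "n = (norm (descent_dir f x0))\<^sup>2"
      have avg_n: "avg K = n" if "1 \<le> K" for K
      proof -
        have "0 < (\<Sum>k<K. \<alpha> k)" using \<alpha>_pos that by (intro sum_pos) (auto simp: lessThan_empty_iff)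
        then show ?thesis
          unfolding avg_def const[of "Xa _ _ _"] n_def
          by (simp add: prob_space flip: sum_distrib_right)
      qed
      have "n \<le> 0"
      proof (rule ccontr)
        assume "\<not> n \<le> 0"
        then have n: "0 < n" by simp
        \<comment> \<open>A K so large that b / ln(K+1) falls below the supposedly positive constant
          value of the averages.\<close>
        obtain K :: nat where K: "exp (b / n) < real K" using reals_Archimedean2 by blast
        have "0 < real K" using exp_gt_zero K by (rule less_trans)
        then have K1: "1 \<le> K" by simp
        have "b / n = ln (exp (b / n))" by simp
        also have "\<dots> < ln (real K + 1)" using K by (subst ln_less_cancel_iff) auto
        finally have "b < n * ln (real K + 1)" using n by (simp add: field_simps)
        moreover have "n \<le> b / ln (real K + 1)" using avg[OF K1] avg_n[OF K1] by simp
        moreover have "0 < ln (real K + 1)" using K1 by simp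
        ultimately show False by (simp add: field_simps)
      qed
      then show ?thesis using avg_n Q by (intro exI[of _ 1]) simp
    qed
  next
    assume ok: "\<forall>k. iterate_ok f G N Cf \<delta> Finf M (Xb k)"
    define D where "D = Dbar Cf TYPE((real ^ 'n) \<times> (real ^ 'm))"
    define M2K where "M2K K = Max ((\<lambda>k. M2 D (Mstar CARD('m) Cf \<delta>) \<theta> r ((k + 1)\<^sup>2)) ` {..<K})" for K
    \<comment> \<open>The value at k = 0, where \<open>S\<close> = 1. Index 0 occurs in every
      maximum with K \<ge> 1, so \<mu> bounds them all from below.\<close>
    define \<mu> where "\<mu> = M2 D (Mstar CARD('m) Cf \<delta>) \<theta> r ((0 + 1)\<^sup>2)"
    have \<mu>: "0 < \<mu>" unfolding \<mu>_def by (rule M2_pos[OF r _ \<theta> Ms]) simp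
    have M2K: "\<mu> \<le> M2K K" if "1 \<le> K" for K
      unfolding \<mu>_def M2K_def using that
      by (intro Max_ge finite_imageI finite_lessThan image_eqI[of _ _ 0]) auto
    define avg where "avg K = (1 / (\<Sum>k<K. \<alpha> k)) *
      (\<Sum>k<K. \<alpha> k * (\<integral>w. (norm (descent_dir f (Xb k w)))\<^sup>2 \<partial>M))" for K
    have Xb': "Xb k = iter (\<lambda>k. (k + 1)\<^sup>2) k" for k
      by (rule ext) (simp add: Xb iter_def)
    have avg: "avg K \<le> b / ln (real K + 1)" if "1 \<le> K" for K
      unfolding avg_def Xb'
    proof (rule le_b[OF _ _ that])
      show "iterate_ok f G N Cf \<delta> Finf M (iter (\<lambda>k. (k + 1)\<^sup>2) k)" for k
        using ok unfolding Xb' by blast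
    qed auto
    define z where "z = (\<Sum>k. 1 / real (Suc k) powr (3 / 2))"
    have "summable (\<lambda>k. real k powr (-(3 / 2)))" by (subst summable_real_powr_iff) simp
    then have "summable (\<lambda>k. real (Suc k) powr (-(3 / 2)))" by (subst summable_Suc_iff)
    then have "summable (\<lambda>k. 1 / real (Suc k) powr (3 / 2))"
      unfolding powr_minus inverse_eq_divide .
    then have z: "0 < z" unfolding z_def by (rule suminf_pos) simp
    define Q where "Q K = Max {L * real CARD('m) * Cf\<^sup>2 * \<rho> * pi\<^sup>2 / 3, 2 * z * Cf * sqrt (M2K K),
      2 * (\<Sum>k. 1 / real (Suc k) ^ 3) * L * \<rho> * M2K K, 2 * Mf / \<rho>}" for K
    \<comment> \<open>The second entry of the maximum with \<mu> in place of \<open>M2K\<close>: a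
      positive lower bound for \<open>Q K\<close> independent of K, which makes b/B an admissible
      constant.\<close>
    define B where "B = 2 * z * Cf * sqrt \<mu>"
    have B: "0 < B" using z Cf \<mu> by (simp add: B_def)
    have "avg K \<le> (b / B) * (Q K * (1 / ln (real K + 1)))" if K: "1 \<le> K" for K
    proof -
      have "B \<le> 2 * z * Cf * sqrt (M2K K)"
        unfolding B_def using z Cf M2K[OF K] by (intro mult_left_mono) auto
      also have "\<dots> \<le> Q K" unfolding Q_def by (intro Max_ge) auto
      finally have "(b / B) * B \<le> (b / B) * Q K" using b B by (intro mult_left_mono) auto
      then have "b / ln (real K + 1) \<le> (b / B) * Q K / ln (real K + 1)"
        using B K by (intro divide_right_mono) auto
      with avg[OF K] show ?thesis by simp
    qed
    then show "\<exists>c>0. \<forall>K\<ge>1. let M2K = M2K K in avg K \<le> c *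
        (Max {L * real CARD('m) * Cf\<^sup>2 * \<rho> * pi\<^sup>2 / 3, 2 * z * Cf * sqrt M2K,
          2 * (\<Sum>k. 1 / real (Suc k) ^ 3) * L * \<rho> * M2K, 2 * Mf / \<rho>} * (1 / ln (real K + 1)))"
      using b B unfolding Let_def Q_def[symmetric] by (intro exI[of _ "b / B"]) auto
  qed
qed

end
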